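(* Let $Q$ be a quadrangulation of the polygon with $2n+2$ vertices. The oriented flip graph $\Gamma_Q$ is the Hasse diagram of a connected poset. The undirected flip graph $\gamma_Q$ is connected.
   Context: Quadrangulations. Consider a regular polygon with $2n+2$ vertices ($n\ge 1$), numbered $0,\dots,2n+1$ clockwise (indices mod $2n+2$). A quadrangulation is a set of pairwise noncrossing diagonals cutting the polygon into quadrilaterals; there are then $n$ quadrilaterals, called squares, and $n-1$ diagonals, called inner edges. The $2n+2$ sides of the polygon are the boundary edges. Vertices are coloured alternately black and white; an edge (boundary or inner) always joins a white and a black vertex and is oriented from white to black. Compatibility. Fix a quadrangulation $Q$, drawn in a "blue" polygon with vertices $b_0,\dots,b_{2n+1}$. Let the "red" polygon, with vertices $r_0,\dots,r_{2n+1}$, be the blue one rotated clockwise by the angle $2\pi/(4n+4)$, so that the clockwise order on the circle is $b_0,r_0,b_1,r_1,\dots,b_{2n+1},r_{2n+1}$; $r_i$ has the same colour as $b_i$. A red edge is compatible with a blue edge if either they do not cross, or they cross and the pair (direction of the red edge, direction of the blue edge) is a positively oriented basis of the plane. A red edge is $Q$-compatible if it is compatible with all edges of $Q$. A $Q$-compatible quadrangulation is a quadrangulation $Q'$ of the red polygon all of whose edges are $Q$-compatible. (None of this depends on which of the two alternating colourings is chosen.) Flips. For a $Q$-compatible quadrangulation $Q'$ and an inner edge $i$ of $Q'$, there is exactly one other inner edge $j$ such that $(Q'\setminus\{i\})\cup\{j\}$ is a $Q$-compatible quadrangulation; replacing $i$ by $j$ is a flip. The flip takes place in the hexagon $H$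 formed by the two squares of $Q'$ adjacent to $i$. There is always an inner edge of $Q$ (a long inner edge) that crosses two opposite sides of $H$, entering (for its white-to-black orientation) through one and leaving through the opposite one; all long inner edges enter through the same side and leave through the same side. Of the two $Q$-compatible diagonals of $H$, one, called (id), has its white endpoint on the side through which long inner edges enter $H$, and the other, called (op), has its white endpoint on the side through which they leave $H$. The flip is oriented from the quadrangulation containing (id) to the quadrangulation containing (op). $\Gamma_Q$ is the directed graph whose vertices are the $Q$-compatible quadrangulations and whose arrows are the oriented flips; $\gamma_Q$ is its underlying undirected graph. A directed graph is the Hasse diagram of a partial order if its arrows are exactly the covering relations of the partial order; by convention the order decreases along arrows. A poset is connected if its Hasse diagram is connected as an undirected graph. *)

theory Defs
  imports "HOL-Analysis.Analysis"
begin

section \<open>The two polygons\<close>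

text \<open>
  Both polygons are inscribed in the unit circle of the complex plane. Vertices are indexed by
  \<open>{..<2 * n + 2}\<close>, clockwise, hence the negative angles. A vertex index denotes a vertex of
  either polygon, so the geometric notions below take the position map (\<open>blue n\<close> or \<open>red n\<close>)
  as an argument \<open>p\<close> or \<open>q\<close>.
\<close>

definition blue :: "nat \<Rightarrow> nat \<Rightarrow> complex" where
  "blue n i = cis (- (2 * pi * real i / real (2 * n + 2)))"

definition red :: "nat \<Rightarrow> nat \<Rightarrow> complex" where
  "red n i = cis (- (2 * pi / real (4 * n + 4))) * blue n i"

text \<open>
  The white vertices are the even ones, in both polygons. An edge joins a white and a black vertex;
  it is the pair (white end, black end), and its direction is from the first to the second
  component. Diagonals joining two vertices of the same colour are left out: they cut off a polygon
  with an odd number of vertices, so they occur in no quadrangulation.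
\<close>

type_synonym edge = "nat \<times> nat"

definition edges :: "nat \<Rightarrow> edge set" where
  "edges n = {(w, b). w < 2 * n + 2 \<and> b < 2 * n + 2 \<and> even w \<and> odd b}"

definition boundary :: "nat \<Rightarrow> edge set" where
  "boundary n = {(w, b) \<in> edges n. b = (w + 1) mod (2 * n + 2) \<or> w = (b + 1) mod (2 * n + 2)}"

definition diagonals :: "nat \<Rightarrow> edge set" where
  "diagonals n = edges n - boundary n"

text \<open>
  Open chords: two distinct chords of one polygon that share an endpoint do not cross.
  For \<open>chord\<close> and \<open>crosses\<close> the order of the two endpoints is irrelevant, and pairs of vertices of
  any colours are allowed.
\<close>

definition chord :: "(nat \<Rightarrow> complex) \<Rightarrow> nat \<times> nat \<Rightarrow> complex set" where
  "chord p e = open_segment (p (fst e)) (p (snd e))"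

definition crosses ::
    "(nat \<Rightarrow> complex) \<Rightarrow> nat \<times> nat \<Rightarrow> (nat \<Rightarrow> complex) \<Rightarrow> nat \<times> nat \<Rightarrow> bool" where
  "crosses p e q f \<longleftrightarrow> chord p e \<inter> chord q f \<noteq> {}"

definition direction :: "(nat \<Rightarrow> complex) \<Rightarrow> edge \<Rightarrow> complex" where
  "direction p e = p (snd e) - p (fst e)"

text \<open>\<open>Im (cnj u * v)\<close> is the determinant of the pair \<open>(u, v)\<close> of plane vectors.\<close>

definition positive_basis :: "complex \<Rightarrow> complex \<Rightarrow> bool" where
  "positive_basis u v \<longleftrightarrow> Im (cnj u * v) > 0"


section \<open>Quadrangulations\<close>

text \<open>
  A quadrangulation is given by its set of inner edges. The regions are the open pieces into which
  these cut the interior of the polygon; a square is represented by its set of four vertices.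
\<close>

definition regions :: "nat \<Rightarrow> (nat \<Rightarrow> complex) \<Rightarrow> edge set \<Rightarrow> complex set set" where
  "regions n p D =
     components (interior (convex hull (p ` {..<2 * n + 2})) - (\<Union>e\<in>D. chord p e))"

definition squares :: "nat \<Rightarrow> (nat \<Rightarrow> complex) \<Rightarrow> edge set \<Rightarrow> nat set set" where
  "squares n p D =
     {S. S \<subseteq> {..<2 * n + 2} \<and> card S = 4 \<and> interior (convex hull (p ` S)) \<in> regions n p D}"

definition quadrangulation :: "nat \<Rightarrow> (nat \<Rightarrow> complex) \<Rightarrow> edge set \<Rightarrow> bool" where
  "quadrangulation n p D \<longleftrightarrow>
     D \<subseteq> diagonals n \<and>
     pairwise (\<lambda>e f. \<not> crosses p e p f) D \<and>
     (\<forall>R\<in>regions n p D. \<exists>S\<in>squares n p D. R = interior (convex hull (p ` S)))"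


section \<open>Compatibility\<close>

definition compatible :: "nat \<Rightarrow> edge \<Rightarrow> edge \<Rightarrow> bool" where
  "compatible n e f \<longleftrightarrow>
     \<not> crosses (red n) e (blue n) f \<or>
     positive_basis (direction (red n) e) (direction (blue n) f)"

definition compatible_edge :: "nat \<Rightarrow> edge set \<Rightarrow> edge \<Rightarrow> bool" where
  "compatible_edge n Q e \<longleftrightarrow> (\<forall>f\<in>Q \<union> boundary n. compatible n e f)"

definition compatible_quadrangulations :: "nat \<Rightarrow> edge set \<Rightarrow> edge set set" where
  "compatible_quadrangulations n Q =
     {Q'. quadrangulation n (red n) Q' \<and> (\<forall>e\<in>Q' \<union> boundary n. compatible_edge n Q e)}"


section \<open>Oriented flips\<close>

definition flip :: "nat \<Rightarrow> edge set \<Rightarrow> edge set \<Rightarrow> edge \<Rightarrow> edge \<Rightarrow> edge set \<Rightarrow> bool" where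
  "flip n Q Q' i j Q'' \<longleftrightarrow>
     Q' \<in> compatible_quadrangulations n Q \<and> i \<in> Q' \<and> j \<notin> Q' \<and>
     Q'' = insert j (Q' - {i}) \<and> Q'' \<in> compatible_quadrangulations n Q"

text \<open>The vertex set of the hexagon in which the inner edge \<open>i\<close> of \<open>Q'\<close> is flipped.\<close>

definition is_hexagon :: "nat \<Rightarrow> edge set \<Rightarrow> edge \<Rightarrow> nat set \<Rightarrow> bool" where
  "is_hexagon n Q' i H \<longleftrightarrow>
     (\<exists>S\<in>squares n (red n) Q'. \<exists>T\<in>squares n (red n) Q'.
        S \<noteq> T \<and> {fst i, snd i} \<subseteq> S \<and> {fst i, snd i} \<subseteq> T \<and> H = S \<union> T)"

text \<open>
  Increasing order of the vertices is their clockwise order, so these are the six sides of a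
  hexagon; side \<open>k\<close> is opposite to side \<open>k + 3\<close>, modulo 6. The order of the two endpoints of a side
  does not refer to colours.
\<close>

definition side :: "nat set \<Rightarrow> nat \<Rightarrow> nat \<times> nat" where
  "side H k = (sorted_list_of_set H ! (k mod 6), sorted_list_of_set H ! (Suc k mod 6))"

text \<open>
  The blue edge \<open>l\<close>, travelled from its white to its black end, crosses the side \<open>s\<close> of a red
  hexagon and afterwards the side \<open>t\<close>. As the hexagon is convex, \<open>l\<close> enters it through \<open>s\<close> and
  leaves it through \<open>t\<close>.
\<close>

definition enters_leaves :: "nat \<Rightarrow> edge \<Rightarrow> nat \<times> nat \<Rightarrow> nat \<times> nat \<Rightarrow> bool" where
  "enters_leaves n l s t \<longleftrightarrow>
     (\<exists>x y. 0 < x \<and> x < y \<and> y < 1 \<and>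
        linepath (blue n (fst l)) (blue n (snd l)) x \<in> chord (red n) s \<and>
        linepath (blue n (fst l)) (blue n (snd l)) y \<in> chord (red n) t)"

text \<open>
  \<open>l\<close> is a long inner edge for the hexagon \<open>H\<close>; \<open>i\<close>, with its white end on the side through which
  \<open>l\<close> enters, is the diagonal (id), and \<open>j\<close>, with its white end on the side through which \<open>l\<close>
  leaves, is (op).
\<close>

definition oriented_flips :: "nat \<Rightarrow> edge set \<Rightarrow> (edge set \<times> edge set) set" where
  "oriented_flips n Q =
     {(Q', Q''). \<exists>i j H. flip n Q Q' i j Q'' \<and> is_hexagon n Q' i H \<and>
        (\<exists>l\<in>Q. \<exists>k<6. enters_leaves n l (side H k) (side H (k + 3)) \<and>
           fst i \<in> {fst (side H k), snd (side H k)} \<and>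
           fst j \<in> {fst (side H (k + 3)), snd (side H (k + 3))})}"


section \<open>Graphs and posets\<close>

text \<open>Directed graphs are pairs of a vertex set and a set of arrows. \<open>flip_digraph n Q\<close> is
  $\Gamma_Q$, \<open>flip_graph n Q\<close> is $\gamma_Q$.\<close>

definition flip_digraph :: "nat \<Rightarrow> edge set \<Rightarrow> edge set set \<times> (edge set \<times> edge set) set" where
  "flip_digraph n Q = (compatible_quadrangulations n Q, oriented_flips n Q)"

text \<open>Undirected graphs are pairs of a vertex set and a set of two-element sets of vertices.\<close>

definition underlying_graph :: "'a set \<times> ('a \<times> 'a) set \<Rightarrow> 'a set \<times> 'a set set" where
  "underlying_graph G = (fst G, {{x, y} | x y. (x, y) \<in> snd G})"

definition flip_graph :: "nat \<Rightarrow> edge set \<Rightarrow> edge set set \<times> edge set set set" where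
  "flip_graph n Q = underlying_graph (flip_digraph n Q)"

text \<open>The empty graph does not count as connected.\<close>

definition connected_graph :: "'a set \<times> 'a set set \<Rightarrow> bool" where
  "connected_graph G \<longleftrightarrow>
     fst G \<noteq> {} \<and> (\<forall>x\<in>fst G. \<forall>y\<in>fst G. (x, y) \<in> {(u, v). {u, v} \<in> snd G}\<^sup>*)"

text \<open>
  The pair \<open>(x, y)\<close> belongs to the order relation \<open>r\<close> on \<open>A\<close> iff \<open>x \<le> y\<close>. There is an arrow from
  \<open>x\<close> to \<open>y\<close> iff \<open>x\<close> covers \<open>y\<close>: the order decreases along arrows.
\<close>

definition hasse_diagram :: "'a set \<Rightarrow> 'a rel \<Rightarrow> 'a set \<times> ('a \<times> 'a) set" where
  "hasse_diagram A r =
     (A, {(x, y). (y, x) \<in> r \<and> y \<noteq> x \<and>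
            \<not> (\<exists>z. (y, z) \<in> r \<and> (z, x) \<in> r \<and> z \<noteq> x \<and> z \<noteq> y)})"

definition connected_poset :: "'a set \<Rightarrow> 'a rel \<Rightarrow> bool" where
  "connected_poset A r \<longleftrightarrow> connected_graph (underlying_graph (hasse_diagram A r))"

end

theory Submission
  imports Defs
begin

text \<open>
  The proof first replaces the plane by the cyclic order of the \<open>4 * n + 4\<close> vertices. Chords of a
  polygon inscribed in a circle cross exactly when their ends interleave, and a set of diagonals
  is a quadrangulation exactly when it is a maximal set of pairwise noncrossing diagonals that
  join vertices of different colours (\<open>quadrangulation_iff\<close>). A blue edge \<open>l\<close> splits the red vertices
  into those \<open>west\<close> of it, met when going clockwise from its white end to its black end, and the
  others. A red edge is compatible with \<open>l\<close> unless its black end is west and its white end is not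
  (\<open>compatible_iff\<close>). So every red edge of a compatible quadrangulation that crosses \<open>l\<close> has its white
  end west and its black end east. Measure both ends by their clockwise distance from the white
  end of \<open>l\<close>: the edge becomes a point with two coordinates, and two such edges cross exactly when
  one point is strictly larger than the other in both coordinates. The edges of a compatible
  quadrangulation that cross \<open>l\<close> therefore form a staircase. An oriented flip takes place in a
  hexagon with two opposite sides crossed by some \<open>l\<close>; it replaces the staircase corner (id), which
  has the smaller coordinates, by the corner (op), which is strictly larger in both
  (\<open>oriented_flips_iff\<close>).

  For the order, let \<open>under l D\<close> be the set of points strictly below the staircase of \<open>D\<close> along \<open>l\<close>.
  Along an arrow no set \<open>under l D\<close> shrinks, for any edge \<open>l\<close> of \<open>Q\<close>: an edge of \<open>Q\<close> that crosses the
  removed diagonal also crosses one of the two opposite sides of the hexagon, whose points are at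
  least as large, since otherwise it would cross the new diagonal in the forbidden direction
  (\<open>under_mono\<close>). Along a long edge, the removed diagonal itself gets into \<open>under l D\<close>, and it can
  never be an edge while it is there. Hence a removed edge never returns
  (\<open>removed_edge_never_returns\<close>), and there is no directed cycle. Moreover, if some path runs
  parallel to an arrow from \<open>x\<close> to \<open>y\<close>, its first flip removes an edge that is missing from \<open>y\<close>, hence
  the same edge as the arrow does; then the two flips agree, and the path is the arrow
  (\<open>oriented_flips_reduced\<close>). So the arrows are the covering relations of the order that they
  generate.

  For connectedness, \<open>Q\<close> with its vertices read as red ones is a compatible quadrangulation, and
  every other compatible quadrangulation \<open>D\<close> is the target of an arrow (\<open>incoming_flip\<close>). For an edge
  \<open>l\<close> of \<open>Q\<close> that is missing from \<open>D\<close>, the staircase along \<open>l\<close> does not consist of one vertical and one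
  horizontal run meeting in \<open>l\<close>, the smallest of all points; so it has an outer corner, an edge that
  shares its black end with the previous edge and its white end with the next one. Flipping this
  edge backwards gives a diagonal that is automatically compatible, because an edge of \<open>Q\<close> crossing
  it in the forbidden direction would cross \<open>l\<close>. As the graph is finite and has no directed cycle,
  going backwards along arrows always ends in \<open>Q\<close>.
\<close>

section \<open>Orientation of point triples\<close>

text \<open>
  Twice the signed area of the triangle \<open>a b z\<close>; it is negative when \<open>a\<close>, \<open>b\<close>, \<open>z\<close> run clockwise, that is,
  when \<open>z\<close> lies to the right of the line from \<open>a\<close> to \<open>b\<close>.
\<close>

definition orient :: "complex \<Rightarrow> complex \<Rightarrow> complex \<Rightarrow> real" where
  "orient a b z = Im (cnj (b - a) * (z - a))"

lemma orient_expand: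
  "orient a b z = (Re b - Re a) * (Im z - Im a) - (Im b - Im a) * (Re z - Re a)"
  by (simp add: orient_def algebra_simps)

lemma orient_rotate: "orient a b c = orient b c a"
  and orient_swap: "orient b a c = - orient a b c"
  and orient_left [simp]: "orient a b a = 0"
  and orient_right [simp]: "orient a b b = 0"
  by (simp_all add: orient_expand algebra_simps)

lemma orient_affine:
  "orient a b ((1 - t) *\<^sub>R c + t *\<^sub>R d) = (1 - t) * orient a b c + t * orient a b d"
  by (simp add: orient_expand algebra_simps)

lemma orient_inner: "orient a b z = inner (\<i> * (b - a)) z - inner (\<i> * (b - a)) a"
  by (simp add: orient_expand inner_complex_def algebra_simps)

lemma closed_right_half_plane: "convex {z. orient a b z \<le> 0}" "closed {z. orient a b z \<le> 0}"
  using convex_halfspace_le[of "\<i> * (b - a)" "inner (\<i> * (b - a)) a"]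
    closed_halfspace_le[of "\<i> * (b - a)" "inner (\<i> * (b - a)) a"]
  by (simp_all add: orient_inner)

lemma open_right_half_plane: "open {z. orient a b z < 0}"
  using open_halfspace_lt[of "\<i> * (b - a)" "inner (\<i> * (b - a)) a"]
  by (simp add: orient_inner)

lemma interior_right_half_plane:
  "a \<noteq> b \<Longrightarrow> interior {z. orient a b z \<le> 0} = {z. orient a b z < 0}"
  using interior_halfspace_le[of "\<i> * (b - a)" "inner (\<i> * (b - a)) a"]
  by (simp add: orient_inner)

lemma hull_right_half_plane:
  assumes "\<And>x. x \<in> X \<Longrightarrow> orient a b x \<le> 0" and "z \<in> convex hull X"
  shows "orient a b z \<le> 0"
  using hull_minimal[of X "{z. orient a b z \<le> 0}" convex] closed_right_half_plane(1) assms by blast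

lemma interior_hull_right_half_plane:
  assumes "\<And>x. x \<in> X \<Longrightarrow> orient a b x \<le> 0" and "a \<noteq> b" and "z \<in> interior (convex hull X)"
  shows "orient a b z < 0"
proof -
  have "convex hull X \<subseteq> {z. orient a b z \<le> 0}"
    using hull_right_half_plane assms(1) by blast
  then show ?thesis
    using interior_mono interior_right_half_plane[OF assms(2)] assms(3) by blast
qed

text \<open>
  The areas of the three triangles that \<open>z\<close> spans with the sides are, up to a common factor, its
  barycentric coordinates.
\<close>

lemma in_triangle:
  assumes "orient a b c < 0" "orient a b z \<le> 0" "orient b c z \<le> 0" "orient c a z \<le> 0"
  shows "z \<in> convex hull {a, b, c}"
proof -
  define s where "s = orient a b c"
  have s: "s < 0" using assms s_def by simp
  have sum: "orient a b z + orient b c z + orient c a z = s"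
    by (simp add: s_def orient_expand algebra_simps)
  have "s *\<^sub>R z = orient b c z *\<^sub>R a + orient c a z *\<^sub>R b + orient a b z *\<^sub>R c"
    by (simp add: s_def complex_eq_iff orient_expand algebra_simps)
  then have "z = (orient b c z / s) *\<^sub>R a + (orient c a z / s) *\<^sub>R b + (orient a b z / s) *\<^sub>R c"
    using s by (simp add: complex_eq_iff field_simps)
  moreover have "orient b c z / s + orient c a z / s + orient a b z / s = 1"
    using sum s by (simp add: field_simps)
  moreover have "orient b c z / s \<ge> 0" "orient c a z / s \<ge> 0" "orient a b z / s \<ge> 0"
    using s assms by (simp_all add: divide_nonpos_neg)
  ultimately show ?thesis unfolding convex_hull_3 by blast
qed

text \<open>
  The diagonal from \<open>c\<close> to \<open>a\<close> cuts the quadrilateral into two triangles.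
\<close>

lemma in_quadrilateral:
  assumes "orient a b c < 0" "orient c d a < 0"
    "orient a b z \<le> 0" "orient b c z \<le> 0" "orient c d z \<le> 0" "orient d a z \<le> 0"
  shows "z \<in> convex hull {a, b, c, d}"
proof (cases "orient c a z \<le> 0")
  case True
  then have "z \<in> convex hull {a, b, c}" using in_triangle assms by blast
  then show ?thesis using hull_mono[of "{a, b, c}" "{a, b, c, d}" convex] by blast
next
  case False
  then have "z \<in> convex hull {c, d, a}"
    using in_triangle[of c d a z] assms orient_swap[of a c z] by auto
  then show ?thesis using hull_mono[of "{c, d, a}" "{a, b, c, d}" convex] by blast
qed

text \<open>
  With \<open>z\<close> at parameter \<open>t\<close> on the line through \<open>a\<close> and \<open>b\<close>, its squared norm is \<open>1 - t * (1 - t) * (cmod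
  (b - a))^2\<close>, which is below 1 only for \<open>0 < t < 1\<close>.
\<close>

lemma on_chord_of_disc:
  assumes "cmod a = 1" "cmod b = 1" "a \<noteq> b" "cmod z < 1" "orient a b z = 0"
  shows "z \<in> open_segment a b"
proof -
  define u where "u = b - a"
  have u0: "u \<noteq> 0" using assms u_def by simp
  define t where "t = Re (cnj u * (z - a)) / (cmod u)^2"
  have "cnj u * (z - a) = of_real (Re (cnj u * (z - a)))"
    using assms(5) by (simp add: orient_def u_def complex_eq_iff)
  then have "u * (cnj u * (z - a)) = u * of_real (Re (cnj u * (z - a)))" by simp
  then have "of_real ((cmod u)^2) * (z - a) = u * of_real (Re (cnj u * (z - a)))"
    by (metis complex_norm_square mult.assoc)
  then have "z - a = of_real t * u"
    using u0 by (simp add: t_def divide_simps mult.commute)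
  then have za: "z = (1 - t) *\<^sub>R a + t *\<^sub>R b"
    by (simp add: u_def scaleR_conv_of_real algebra_simps)
  have "(cmod z)^2 = (1 - t) * (cmod a)^2 + t * (cmod b)^2 - t * (1 - t) * (cmod (b - a))^2"
    unfolding za cmod_power2 by (simp add: algebra_simps power2_eq_square)
  then have "(cmod z)^2 = 1 - t * (1 - t) * (cmod u)^2" using assms(1,2) by (simp add: u_def)
  moreover have "(cmod z)^2 < 1" using assms(4) by (simp add: power_less_one_iff)
  ultimately have "t * (1 - t) * (cmod u)^2 > 0" by simp
  then have "t * (1 - t) > 0" using u0 by (simp add: zero_less_mult_iff)
  then have "0 < t" "t < 1" by (auto simp: zero_less_mult_iff)
  then show ?thesis using za assms(3) by (auto simp: in_segment)
qed

text \<open>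
  The two lines meet at parameters that are quotients of the four areas; the signs put both
  parameters between 0 and 1.
\<close>

lemma open_segments_meet:
  assumes "orient a b c * orient a b d < 0" "orient c d a * orient c d b < 0"
  shows "open_segment a b \<inter> open_segment c d \<noteq> {}"
proof -
  define r where "r = orient a b c - orient a b d"
  have r: "r \<noteq> 0" using assms(1) unfolding r_def by (auto simp: mult_less_0_iff)
  have r': "r = orient c d b - orient c d a" by (simp add: r_def orient_expand algebra_simps)
  define t s where "t = orient a b c / r" and "s = - orient c d a / r"
  have t: "0 < t" "t < 1" using assms(1) r
    unfolding t_def r_def by (auto simp: mult_less_0_iff field_simps)
  have s: "0 < s" "s < 1" using assms(2) r
    unfolding s_def r' by (auto simp: mult_less_0_iff field_simps)
  have "r *\<^sub>R ((1 - t) *\<^sub>R c + t *\<^sub>R d) = (r - orient a b c) *\<^sub>R c + orient a b c *\<^sub>R d"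
    using r by (simp add: t_def scaleR_add_right right_diff_distrib)
  also have "\<dots> = (r + orient c d a) *\<^sub>R a - orient c d a *\<^sub>R b"
    by (simp add: r_def complex_eq_iff orient_expand algebra_simps)
  also have "\<dots> = r *\<^sub>R ((1 - s) *\<^sub>R a + s *\<^sub>R b)"
    using r by (simp add: s_def scaleR_add_right scaleR_diff_right distrib_left algebra_simps)
  finally have "(1 - t) *\<^sub>R c + t *\<^sub>R d = (1 - s) *\<^sub>R a + s *\<^sub>R b" using r by simp
  moreover have "a \<noteq> b" "c \<noteq> d" using assms by (auto simp: orient_expand)
  ultimately have "(1 - t) *\<^sub>R c + t *\<^sub>R d \<in> open_segment a b \<inter> open_segment c d"
    unfolding in_segment Int_iff using t s by metis
  then show ?thesis by blast
qed

lemma orient_segment_sign: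
  assumes "z \<in> open_segment c d"
  shows "orient a b c \<le> 0 \<Longrightarrow> orient a b d \<le> 0 \<Longrightarrow> orient a b z \<le> 0"
    and "orient a b c \<le> 0 \<Longrightarrow> orient a b d \<le> 0 \<Longrightarrow> orient a b c < 0 \<or> orient a b d < 0
      \<Longrightarrow> orient a b z < 0"
proof -
  obtain t where t: "0 < t" "t < 1" "z = (1 - t) *\<^sub>R c + t *\<^sub>R d"
    using assms by (auto simp: in_segment)
  have e: "orient a b z = (1 - t) * orient a b c + t * orient a b d" using t orient_affine by simp
  show "orient a b c \<le> 0 \<Longrightarrow> orient a b d \<le> 0 \<Longrightarrow> orient a b z \<le> 0"
    using e t by (simp add: add_nonpos_nonpos mult_nonneg_nonpos)
  have "(1 - t) * orient a b c < 0" if "orient a b c < 0" using that t by (simp add: mult_pos_neg)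
  moreover have "t * orient a b d < 0" if "orient a b d < 0"
    using that t by (simp add: mult_pos_neg)
  moreover have "(1 - t) * orient a b c \<le> 0" if "orient a b c \<le> 0"
    using that t by (simp add: mult_nonneg_nonpos)
  moreover have "t * orient a b d \<le> 0" if "orient a b d \<le> 0"
    using that t by (simp add: mult_nonneg_nonpos)
  ultimately show "orient a b c \<le> 0 \<Longrightarrow> orient a b d \<le> 0 \<Longrightarrow> orient a b c < 0 \<or> orient a b d < 0
      \<Longrightarrow> orient a b z < 0"
    unfolding e by (meson add_neg_nonpos add_nonpos_neg)
qed

text \<open>
  For points on the unit circle the sign of the area can be read off from the half differences of
  the angles.
\<close>

lemma orient_cis:
  "orient (cis (- u)) (cis (- v)) (cis (- w)) =
     - 4 * sin ((v - u) / 2) * sin ((w - v) / 2) * sin ((w - u) / 2)"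
proof -
  define x y where "x = (v - u) / 2" and "y = (w - v) / 2"
  have h: "(w - u) / 2 = x + y" by (simp add: x_def y_def field_simps)
  have "orient (cis (- u)) (cis (- v)) (cis (- w)) = sin (u - v) + sin (v - w) + sin (w - u)"
    by (simp add: orient_expand sin_diff algebra_simps)
  also have "\<dots> = - sin (2 * x) - sin (2 * y) + sin (2 * (x + y))"
  proof -
    have eqs: "u - v = - (2 * x)" "v - w = - (2 * y)" "w - u = 2 * (x + y)"
      unfolding x_def y_def by (simp_all add: field_simps)
    show ?thesis unfolding eqs by simp
  qed
  also have "\<dots> = - 4 * sin x * sin y * sin (x + y)"
  proof -
    have "sin (2 * x) + sin (2 * y) = 2 * sin (x + y) * cos (x - y)"
      by (simp add: sin_plus_sin field_simps add_divide_distrib diff_divide_distrib)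
    moreover have "sin (2 * (x + y)) = 2 * sin (x + y) * cos (x + y)" by (rule sin_double)
    moreover have "cos (x - y) - cos (x + y) = 2 * sin x * sin y"
      by (simp add: cos_diff cos_add)
    ultimately show ?thesis by algebra
  qed
  finally show ?thesis by (simp add: h flip: x_def y_def)
qed

section \<open>Cyclic order of vertices\<close>

text \<open>
  \<open>a\<close>, \<open>b\<close>, \<open>c\<close> are pairwise distinct and are met in this order when running through the indices
  cyclically.
\<close>

definition cyc :: "nat \<Rightarrow> nat \<Rightarrow> nat \<Rightarrow> bool" where
  "cyc a b c \<longleftrightarrow> a < b \<and> b < c \<or> b < c \<and> c < a \<or> c < a \<and> a < b"

definition interleaved :: "nat \<Rightarrow> nat \<Rightarrow> nat \<Rightarrow> nat \<Rightarrow> bool" where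
  "interleaved a b c d \<longleftrightarrow> cyc a c b \<and> cyc b d a \<or> cyc a d b \<and> cyc b c a"

lemma cyc_rotate: "cyc a b c \<Longrightarrow> cyc b c a"
  by (auto simp: cyc_def)

lemma cyc_asym: "cyc a b c \<Longrightarrow> \<not> cyc a c b"
  by (auto simp: cyc_def)

lemma cyc_distinct: "cyc a b c \<Longrightarrow> a \<noteq> b \<and> b \<noteq> c \<and> a \<noteq> c"
  by (auto simp: cyc_def)

lemma cyc_total: "a \<noteq> b \<Longrightarrow> b \<noteq> c \<Longrightarrow> a \<noteq> c \<Longrightarrow> cyc a b c \<or> cyc a c b"
  by (auto simp: cyc_def)

lemma cyc_irrefl [simp]: "\<not> cyc a a b" "\<not> cyc a b a" "\<not> cyc a b b"
  by (auto simp: cyc_def)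

lemma cyc_trans: "cyc a b c \<Longrightarrow> cyc a c d \<Longrightarrow> cyc a b d"
  by (auto simp: cyc_def)

lemma cyc_trans': "cyc a b c \<Longrightarrow> cyc a c d \<Longrightarrow> cyc b c d"
  by (auto simp: cyc_def)

lemmas cyclic_order = cyc_rotate cyc_asym cyc_trans cyc_total

lemma interleaved_sym: "interleaved a b c d \<Longrightarrow> interleaved c d a b"
  and interleaved_flip: "interleaved a b c d \<Longrightarrow> interleaved b a c d"
    "interleaved a b c d \<Longrightarrow> interleaved a b d c"
  unfolding interleaved_def by (meson cyc_rotate cyc_trans)+

lemma not_interleaved_refl [simp]: "\<not> interleaved a b a b" "\<not> interleaved a b b a"
  by (auto simp: interleaved_def cyc_def)

text \<open>
  The number of steps that lead clockwise from \<open>p\<close> to \<open>x\<close> on a polygon with \<open>M\<close> vertices. For a fixed \<open>p\<close>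
  it turns the cyclic order into a linear order that starts with \<open>p\<close>.
\<close>

definition turn :: "nat \<Rightarrow> nat \<Rightarrow> nat \<Rightarrow> nat" where
  "turn M p x = (if p \<le> x then x - p else x + M - p)"

lemma turn_less_iff:
  "p < M \<Longrightarrow> a < M \<Longrightarrow> b < M \<Longrightarrow>
    turn M p a < turn M p b \<longleftrightarrow> p \<le> a \<and> b < p \<or> (p \<le> a \<longleftrightarrow> p \<le> b) \<and> a < b"
  by (auto simp: turn_def)

lemma cyc_turn:
  "p < M \<Longrightarrow> a < M \<Longrightarrow> b < M \<Longrightarrow> c < M \<Longrightarrow> cyc (turn M p a) (turn M p b) (turn M p c) = cyc a b c"
  by (simp only: cyc_def turn_less_iff) (cases "p \<le> a"; cases "p \<le> b"; cases "p \<le> c"; auto)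

lemma cyc_turn_less:
  "p < M \<Longrightarrow> a < M \<Longrightarrow> b < M \<Longrightarrow> cyc p a b \<longleftrightarrow> p \<noteq> a \<and> turn M p a < turn M p b"
  by (simp only: cyc_def turn_less_iff) auto

lemma turn_inj: "p < M \<Longrightarrow> a < M \<Longrightarrow> b < M \<Longrightarrow> turn M p a = turn M p b \<Longrightarrow> a = b"
  by (auto simp: turn_def split: if_splits)

text \<open>
  The blue and the red vertices together are the vertices of one regular polygon with \<open>4 * n + 4\<close>
  vertices: the blue ones are those of even index.
\<close>

definition vert :: "nat \<Rightarrow> nat \<Rightarrow> complex" where
  "vert N m = cis (- (2 * pi * real m / real N))"

locale inscribed_polygon =
  fixes p :: "nat \<Rightarrow> complex" and M :: nat
  assumes unit: "i < M \<Longrightarrow> cmod (p i) = 1"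
    and clockwise: "a < M \<Longrightarrow> b < M \<Longrightarrow> c < M \<Longrightarrow> cyc a b c \<Longrightarrow> orient (p a) (p b) (p c) < 0"
    and distinct: "a < M \<Longrightarrow> b < M \<Longrightarrow> a \<noteq> b \<Longrightarrow> p a \<noteq> p b"
begin

lemma orient_neg_iff:
  assumes "a < M" "b < M" "c < M"
  shows "orient (p a) (p b) (p c) < 0 \<longleftrightarrow> cyc a b c"
proof -
  consider "cyc a b c" | "cyc b a c" | "a = b \<or> b = c \<or> a = c"
    using cyc_total[of b a c] cyc_rotate[of b c a] cyc_rotate[of c a b] by blast
  then show ?thesis
  proof cases
    case 1
    then show ?thesis using clockwise assms by blast
  next
    case 2
    then have "orient (p a) (p b) (p c) > 0"
      using clockwise[of b a c] assms orient_swap[of "p a" "p b" "p c"] by linarith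
    moreover have "\<not> cyc a b c" using 2 by (auto simp: cyc_def)
    ultimately show ?thesis by simp
  next
    case 3
    then have "orient (p a) (p b) (p c) = 0" by (auto simp: orient_expand)
    moreover have "\<not> cyc a b c" using 3 by (auto simp: cyc_def)
    ultimately show ?thesis by simp
  qed
qed

lemma orient_pos_iff:
  assumes "a < M" "b < M" "c < M"
  shows "orient (p a) (p b) (p c) > 0 \<longleftrightarrow> cyc b a c"
  using orient_neg_iff[of b a c] assms orient_swap[of "p b" "p a" "p c"] by linarith

text \<open>
  Neither \<open>c\<close> nor \<open>d\<close> lies strictly to the left of the line from \<open>a\<close> to \<open>b\<close>, and not both lie on it, since
  a line meets the circle in at most two points; so the whole open chord lies strictly to its
  right.
\<close>

lemma segments_disjoint:
  assumes "a < M" "b < M" "c < M" "d < M" "a \<noteq> b" "{a, b} \<noteq> {c, d}" "c \<noteq> d"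
    and "\<not> cyc b a c" "\<not> cyc b a d"
  shows "open_segment (p a) (p b) \<inter> open_segment (p c) (p d) = {}"
proof -
  have "c \<notin> {a, b} \<or> d \<notin> {a, b}" using assms(6,7) by auto
  then have "cyc a b c \<or> cyc a b d"
    using cyc_total[of b a c] cyc_total[of b a d] assms(5,8,9) cyc_rotate by blast
  then have neg: "orient (p a) (p b) z < 0" if "z \<in> open_segment (p c) (p d)" for z
    using orient_segment_sign(2)[OF that, of "p a" "p b"] orient_pos_iff orient_neg_iff assms
    by (meson not_le_imp_less)
  have "orient (p a) (p b) z = 0" if "z \<in> open_segment (p a) (p b)" for z
    using that by (auto simp: in_segment orient_affine)
  then show ?thesis using neg by fastforce
qed

lemma segments_meet_iff_interleaved:
  assumes "a < M" "b < M" "c < M" "d < M" "a \<noteq> b" "c \<noteq> d" "{a, b} \<noteq> {c, d}"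
  shows "open_segment (p a) (p b) \<inter> open_segment (p c) (p d) \<noteq> {} \<longleftrightarrow> interleaved a b c d"
proof
  assume i: "interleaved a b c d"
  have opposite: "orient (p a) (p b) (p c) * orient (p a) (p b) (p d) < 0"
    if "a < M" "b < M" "c < M" "d < M" "interleaved a b c d" for a b c d
    using orient_pos_iff[of a b] orient_neg_iff[of a b] that cyc_rotate
    unfolding interleaved_def mult_less_0_iff by metis
  have "orient (p a) (p b) (p c) * orient (p a) (p b) (p d) < 0"
    using opposite assms i by blast
  moreover have "orient (p c) (p d) (p a) * orient (p c) (p d) (p b) < 0"
    using opposite assms interleaved_sym[OF i] by blast
  ultimately show "open_segment (p a) (p b) \<inter> open_segment (p c) (p d) \<noteq> {}"
    using open_segments_meet by blast
next
  assume m: "open_segment (p a) (p b) \<inter> open_segment (p c) (p d) \<noteq> {}"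
  have "cyc b a c \<or> cyc b a d" using segments_disjoint[of a b c d] assms m by blast
  moreover have "cyc a b c \<or> cyc a b d"
    using segments_disjoint[of b a c d] assms m by (metis insert_commute open_segment_commute)
  ultimately show "interleaved a b c d"
    using cyc_rotate cyc_asym unfolding interleaved_def by metis
qed

definition quadrilateral :: "nat \<Rightarrow> nat \<Rightarrow> nat \<Rightarrow> nat \<Rightarrow> complex set" where
  "quadrilateral a b c d = interior (convex hull {p a, p b, p c, p d})"

text \<open>
  This description by four half planes is what ties regions to the cyclic order: a point is
  strictly inside a square iff it is cut off by none of the four sides.
\<close>

lemma quadrilateral_eq:
  assumes "a < M" "b < M" "c < M" "d < M" "cyc a b c" "cyc a c d"
  shows "quadrilateral a b c d = {z. orient (p a) (p b) z < 0 \<and> orient (p b) (p c) z < 0 \<and>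
    orient (p c) (p d) z < 0 \<and> orient (p d) (p a) z < 0}" (is "_ = ?R")
proof
  have d: "a \<noteq> b" "b \<noteq> c" "c \<noteq> d" "d \<noteq> a"
    using assms(5,6) by (auto simp: cyc_def)
  have inside: "\<not> cyc b a c" "\<not> cyc b a d" "\<not> cyc c b a" "\<not> cyc c b d"
    "\<not> cyc d c a" "\<not> cyc d c b" "\<not> cyc a d b" "\<not> cyc a d c"
    using assms(5,6) by (smt (verit) cyclic_order)+
  have sub: "orient (p x) (p y) z < 0"
    if xy: "x < M" "y < M" "x \<noteq> y"
      and out: "\<not> cyc y x a" "\<not> cyc y x b" "\<not> cyc y x c" "\<not> cyc y x d"
      and z: "z \<in> quadrilateral a b c d" for x y z
  proof (rule interior_hull_right_half_plane)
    show "z \<in> interior (convex hull {p a, p b, p c, p d})"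
      using z by (simp add: quadrilateral_def)
    show "p x \<noteq> p y" using distinct xy by blast
    have "orient (p x) (p y) (p u) \<le> 0" if "u < M" "\<not> cyc y x u" for u
      using orient_pos_iff[of x y u] xy that by simp
    then show "orient (p x) (p y) w \<le> 0" if "w \<in> {p a, p b, p c, p d}" for w
      using that out assms(1-4) by blast
  qed
  show "quadrilateral a b c d \<subseteq> ?R"
    using sub[of a b] sub[of b c] sub[of c d] sub[of d a] inside d assms(1-4) by auto
  have "open ?R" unfolding Collect_conj_eq by (intro open_Int open_right_half_plane)
  moreover have "?R \<subseteq> convex hull {p a, p b, p c, p d}"
    using in_quadrilateral[of "p a" "p b" "p c" "p d"] clockwise assms cyc_rotate less_imp_le
    by blast
  ultimately show "?R \<subseteq> quadrilateral a b c d"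
    unfolding quadrilateral_def by (rule interior_maximal[rotated])
qed

lemma diagonal_in_quadrilateral:
  assumes "a < M" "b < M" "c < M" "d < M" "cyc a b c" "cyc a c d"
  shows "open_segment (p a) (p c) \<subseteq> quadrilateral a b c d"
proof
  fix z assume z: "z \<in> open_segment (p a) (p c)"
  have side: "orient (p x) (p y) z < 0"
    if "x < M" "y < M" "\<not> cyc y x a" "\<not> cyc y x c" "cyc x y a \<or> cyc x y c" for x y
    using orient_segment_sign(2)[OF z, of "p x" "p y"] that assms orient_pos_iff[of x y]
      orient_neg_iff[of x y]
    by (meson not_less)
  have "\<not> cyc b a c" "\<not> cyc c b a" "\<not> cyc d c a" "\<not> cyc a d c"
    "cyc b c a" "cyc c d a" "cyc d a c"
    using assms(5,6) by (smt (verit) cyclic_order)+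
  then show "z \<in> quadrilateral a b c d"
    unfolding quadrilateral_eq[OF assms]
    using side[of a b] side[of b c] side[of c d] side[of d a] assms by simp
qed

end

lemma inscribed_vert:
  assumes "3 \<le> N"
  shows "inscribed_polygon (vert N) N"
proof -
  have neg: "orient (vert N a) (vert N b) (vert N c) < 0" if "a < b" "b < c" "c < N" for a b c
  proof -
    have N: "real N > 0" using that by simp
    have s: "sin ((2 * pi * real y / real N - 2 * pi * real x / real N) / 2) > 0"
      if "x < y" "y < N" for x y :: nat
    proof -
      define r where "r = (real y - real x) / real N"
      have "(2 * pi * real y / real N - 2 * pi * real x / real N) / 2 = pi * r"
        using N by (simp add: r_def field_simps)
      moreover have "0 < r" "r < 1" using that N by (simp_all add: r_def field_simps)
      ultimately show ?thesis by (simp add: sin_gt_zero)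
    qed
    show ?thesis
      unfolding vert_def orient_cis using s[of a b] s[of b c] s[of a c] that
      by (simp add: mult_neg_pos)
  qed
  have neg2: "orient (vert N a) (vert N b) (vert N c) < 0" if "a < N" "b < N" "c < N" "cyc a b c"
    for a b c
    using that neg[of a b c] neg[of b c a] neg[of c a b] orient_rotate unfolding cyc_def by metis
  show ?thesis
  proof
    show "cmod (vert N i) = 1" for i by (simp add: vert_def)
    show "orient (vert N a) (vert N b) (vert N c) < 0" if "a < N" "b < N" "c < N" "cyc a b c"
      for a b c
      using that by (rule neg2)
    show "vert N a \<noteq> vert N b" if "a < N" "b < N" "a \<noteq> b" for a b
    proof
      assume e: "vert N a = vert N b"
      have "\<exists>c<3. c \<noteq> a \<and> c \<noteq> b" by presburger
      then obtain c where c: "c < N" "c \<noteq> a" "c \<noteq> b"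
        using assms by (meson less_le_trans)
      have "orient (vert N a) (vert N b) (vert N c) = 0"
        "orient (vert N b) (vert N a) (vert N c) = 0"
        using e by (simp_all add: orient_expand)
      moreover have "cyc a b c \<or> cyc b a c"
        using cyc_total[of b a c] cyc_rotate that c by blast
      ultimately show False
        using neg2[of a b c] neg2[of b a c] that c by auto
    qed
  qed
qed

section \<open>Maximal noncrossing sets of diagonals\<close>

text \<open>
  An edge is stored with its white end first, but the sides of a square are visited clockwise and
  are white to black and black to white in turn; boundary edges count as sides, too.
\<close>

definition joined :: "nat \<Rightarrow> edge set \<Rightarrow> nat \<Rightarrow> nat \<Rightarrow> bool" where
  "joined n D a b \<longleftrightarrow> (a, b) \<in> D \<union> boundary n \<or> (b, a) \<in> D \<union> boundary n"

definition noncrossing :: "edge set \<Rightarrow> bool" where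
  "noncrossing D \<longleftrightarrow> (\<forall>e\<in>D. \<forall>f\<in>D. \<not> interleaved (fst e) (snd e) (fst f) (snd f))"

definition maximal_noncrossing :: "nat \<Rightarrow> edge set \<Rightarrow> bool" where
  "maximal_noncrossing n D \<longleftrightarrow> D \<subseteq> diagonals n \<and> noncrossing D \<and>
     (\<forall>e\<in>diagonals n - D. \<exists>f\<in>D. interleaved (fst e) (snd e) (fst f) (snd f))"

definition next_vertex :: "nat \<Rightarrow> nat \<Rightarrow> nat" where
  "next_vertex n a = (a + 1) mod (2 * n + 2)"

lemma next_vertex_if: "a < 2 * n + 2 \<Longrightarrow> next_vertex n a = (if a = 2 * n + 1 then 0 else a + 1)"
  by (auto simp: next_vertex_def)

lemma next_vertex_less: "next_vertex n a < 2 * n + 2"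
  by (simp add: next_vertex_def)

lemma even_next_vertex: "even (next_vertex n a) \<longleftrightarrow> odd a"
  by (simp add: next_vertex_def dvd_mod_iff)

lemma not_cyc_next_vertex:
  "a < 2 * n + 2 \<Longrightarrow> c < 2 * n + 2 \<Longrightarrow> \<not> cyc a c (next_vertex n a)"
  by (auto simp: next_vertex_if cyc_def)

lemma cyc_next_vertex:
  "a < 2 * n + 2 \<Longrightarrow> c < 2 * n + 2 \<Longrightarrow> c \<noteq> a \<Longrightarrow> c \<noteq> next_vertex n a \<Longrightarrow> cyc a (next_vertex n a) c"
  by (auto simp: next_vertex_if cyc_def split: if_splits)

lemma edgesD: "e \<in> edges n \<Longrightarrow> fst e < 2 * n + 2 \<and> snd e < 2 * n + 2 \<and> even (fst e) \<and> odd (snd e)"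
  by (auto simp: edges_def)

lemma boundary_edges: "boundary n \<subseteq> edges n"
  by (auto simp: boundary_def)

lemma diagonals_edges: "diagonals n \<subseteq> edges n"
  by (auto simp: diagonals_def)

lemma boundary_iff:
  "(w, b) \<in> boundary n \<longleftrightarrow> (w, b) \<in> edges n \<and> (b = next_vertex n w \<or> w = next_vertex n b)"
  by (auto simp: boundary_def next_vertex_def)

lemma joined_sym: "joined n D a b \<Longrightarrow> joined n D b a"
  by (auto simp: joined_def)

lemma joined_member: "(w, b) \<in> D \<Longrightarrow> joined n D w b"
  by (auto simp: joined_def)

lemma joined_bounds:
  assumes "joined n D a b" "D \<subseteq> diagonals n"
  shows "a < 2 * n + 2" "b < 2 * n + 2" "even a \<longleftrightarrow> odd b"
proof -
  have "(a, b) \<in> edges n \<or> (b, a) \<in> edges n"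
    using assms boundary_edges diagonals_edges unfolding joined_def by blast
  then show "a < 2 * n + 2" "b < 2 * n + 2" "even a \<longleftrightarrow> odd b"
    by (auto simp: edges_def)
qed

lemma joined_neq: "joined n D a b \<Longrightarrow> D \<subseteq> diagonals n \<Longrightarrow> a \<noteq> b"
  using joined_bounds(3) by blast

lemma joined_white:
  assumes "joined n D a b" "D \<subseteq> diagonals n" "even a"
  shows "(a, b) \<in> D \<union> boundary n"
proof -
  have "(b, a) \<notin> edges n" using assms(3) edgesD[of "(b, a)" n] by auto
  then have "(b, a) \<notin> D \<union> boundary n" using assms(2) boundary_edges diagonals_edges by blast
  then show ?thesis using assms(1) by (auto simp: joined_def)
qed

lemma joined_next_vertex:
  assumes "a < 2 * n + 2"
  shows "joined n D a (next_vertex n a)"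
  using assms next_vertex_less[of n a] even_next_vertex[of n a]
    boundary_iff[of a "next_vertex n a" n]
    boundary_iff[of "next_vertex n a" a n]
  by (cases "even a") (auto simp: joined_def edges_def)

lemma boundary_not_interleaved:
  assumes "(a, b) \<in> boundary n" "c < 2 * n + 2" "d < 2 * n + 2"
  shows "\<not> interleaved a b c d"
proof -
  have "a < 2 * n + 2" "b < 2 * n + 2" "b = next_vertex n a \<or> a = next_vertex n b"
    using assms(1) edgesD[of "(a, b)" n] by (auto simp: boundary_iff)
  then show ?thesis
    using not_cyc_next_vertex assms(2,3) unfolding interleaved_def by blast
qed

text \<open>
  Boundary edges join neighbours, so nothing separates their ends.
\<close>

lemma joined_not_interleaved:
  assumes "D \<subseteq> diagonals n" "noncrossing D" "joined n D a b" "joined n D c d"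
  shows "\<not> interleaved a b c d"
proof -
  have D: "\<not> interleaved a b c d" if "(a, b) \<in> D" "(c, d) \<in> D" for a b c d
    using assms(2) that by (force simp: noncrossing_def)
  have B: "\<not> interleaved a b c d" if "(a, b) \<in> D \<union> boundary n" "(c, d) \<in> D \<union> boundary n" for a b c d
    using D[of a b c d] that boundary_not_interleaved interleaved_sym
      joined_bounds[OF _ assms(1), of a b] joined_bounds[OF _ assms(1), of c d]
    by (metis Un_iff joined_def)
  show ?thesis
    using assms(3,4) B interleaved_flip unfolding joined_def by metis
qed

lemma not_joined_crossed:
  assumes "maximal_noncrossing n D" "a < 2 * n + 2" "b < 2 * n + 2" "even a \<longleftrightarrow> odd b"
    "\<not> joined n D a b"
  shows "\<exists>(c, d)\<in>D. interleaved a b c d"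
proof (cases "even a")
  case True
  then have "(a, b) \<in> diagonals n - D"
    using assms by (auto simp: joined_def diagonals_def edges_def)
  then show ?thesis
    using assms(1) unfolding maximal_noncrossing_def case_prod_beta by (metis fst_conv snd_conv)
next
  case False
  then have "(b, a) \<in> diagonals n - D"
    using assms by (auto simp: joined_def diagonals_def edges_def)
  then show ?thesis
    using assms(1) interleaved_flip(1)
      unfolding maximal_noncrossing_def case_prod_beta by (metis fst_conv snd_conv)
qed

text \<open>
  An edge with its end \<open>s\<close> strictly between \<open>y\<close> and \<open>q\<close> leaves the polygon \<open>p x y q\<close> through the missing
  side \<open>y q\<close>, and can cross none of the other three sides; so it ends in \<open>p\<close> or \<open>x\<close>.
\<close>

lemma chord_leaving_gap:
  assumes "cyc p x y" "cyc p y q" "cyc y s q" "cyc q t y"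
    "\<not> interleaved s t p q" "\<not> interleaved s t x y" "\<not> interleaved s t p x"
  shows "t = p \<or> t = x"
  using assms unfolding interleaved_def by (smt (verit) cyclic_order)

text \<open>
  Among the vertices strictly between \<open>p\<close> and \<open>q\<close> to which \<open>p\<close> is joined, such as its successor, take
  the one at the largest clockwise distance.
\<close>

lemma farthest_neighbour:
  assumes "p < 2 * n + 2" "q < 2 * n + 2" "q \<noteq> p" "q \<noteq> next_vertex n p" "D \<subseteq> diagonals n"
  obtains x where "x < 2 * n + 2" "cyc p x q" "joined n D p x"
    "\<And>s. joined n D p s \<Longrightarrow> cyc p s q \<Longrightarrow> \<not> cyc p x s"
proof -
  define X where "X = {x. x < 2 * n + 2 \<and> cyc p x q \<and> joined n D p x}"
  define f where "f = turn (2 * n + 2) p"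
  have "finite X" by (rule finite_subset[of _ "{..<2 * n + 2}"]) (auto simp: X_def)
  moreover have "next_vertex n p \<in> X"
    using assms cyc_next_vertex joined_next_vertex next_vertex_less by (simp add: X_def)
  ultimately have "Max (f ` X) \<in> f ` X" "\<And>x. x \<in> X \<Longrightarrow> f x \<le> Max (f ` X)"
    by (auto intro: Max_in)
  then obtain x where x: "x \<in> X" "\<And>s. s \<in> X \<Longrightarrow> f s \<le> f x" by force
  show ?thesis
  proof (rule that[of x])
    show "x < 2 * n + 2" "cyc p x q" "joined n D p x" using x by (auto simp: X_def)
    fix s assume s: "joined n D p s" "cyc p s q"
    then have "s \<in> X" using joined_bounds(2) assms(5) by (auto simp: X_def)
    then have "f s \<le> f x" using x by blast
    then show "\<not> cyc p x s"
      using cyc_turn_less[of p "2 * n + 2" x s] assms(1) \<open>x < 2 * n + 2\<close> \<open>s \<in> X\<close>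
      by (auto simp: f_def X_def)
  qed
qed

text \<open>
  Let \<open>x\<close> be the farthest neighbour of \<open>p\<close> before \<open>q\<close> and \<open>y\<close> the farthest neighbour of \<open>x\<close> before \<open>q\<close>. An
  edge crossing \<open>y q\<close> would have to end in \<open>p\<close> or \<open>x\<close> and would lead to a farther neighbour of it. So
  nothing crosses \<open>y q\<close>, and maximality makes it an edge.
\<close>

lemma square_on_side:
  assumes "maximal_noncrossing n D" "joined n D p q" "q \<noteq> next_vertex n p"
  obtains x y where "x < 2 * n + 2" "y < 2 * n + 2" "cyc p x y" "cyc p y q"
    "joined n D p x" "joined n D x y" "joined n D y q"
proof -
  have D: "D \<subseteq> diagonals n" "noncrossing D" using assms(1) by (auto simp: maximal_noncrossing_def)
  note pq = joined_bounds[OF assms(2) D(1)]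
  obtain x where x: "x < 2 * n + 2" "cyc p x q" "joined n D p x"
    and x_far: "\<And>s. joined n D p s \<Longrightarrow> cyc p s q \<Longrightarrow> \<not> cyc p x s"
    using farthest_neighbour[OF pq(1,2) _ assms(3) D(1)] pq(3) by metis
  have qx: "q \<noteq> x" using x(2) by auto
  have "q \<noteq> next_vertex n x"
    using even_next_vertex[of n x] pq(3) joined_bounds(3)[OF x(3) D(1)] by auto
  then obtain y where y: "y < 2 * n + 2" "cyc x y q" "joined n D x y"
    and y_far: "\<And>s. joined n D x s \<Longrightarrow> cyc x s q \<Longrightarrow> \<not> cyc x y s"
    using farthest_neighbour[OF x(1) pq(2) qx _ D(1)] by metis
  have order: "cyc p x y" "cyc p y q"
    using x(2) y(2) by (smt (verit) cyclic_order)+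
  have "joined n D y q"
  proof (rule ccontr)
    assume "\<not> joined n D y q"
    moreover have "even y \<longleftrightarrow> odd q"
      using pq(3) joined_bounds(3)[OF x(3) D(1)] joined_bounds(3)[OF y(3) D(1)] by blast
    ultimately obtain c d where cd: "(c, d) \<in> D" "interleaved y q c d"
      using not_joined_crossed[OF assms(1) y(1) pq(2)] by blast
    obtain s t where st: "joined n D s t" "cyc y s q" "cyc q t y"
      using cd joined_sym joined_member unfolding interleaved_def by blast
    have "t = p \<or> t = x"
      using chord_leaving_gap[OF order st(2,3)] joined_not_interleaved[OF D st(1)] assms(2) x(3)
        y(3)
      by blast
    then show False
    proof
      assume "t = p"
      moreover have "cyc p s q" "cyc p x s"
        using order st(2) by (smt (verit) cyclic_order)+
      ultimately show False using x_far st(1) joined_sym by blast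
    next
      assume "t = x"
      moreover have "cyc x s q" "cyc x y s"
        using y(2) st(2) by (smt (verit) cyclic_order)+
      ultimately show False using y_far st(1) joined_sym by blast
    qed
  qed
  then show ?thesis using that x y order by blast
qed

text \<open>
  Two different squares on the same side of an edge would have crossing sides.
\<close>

lemma square_on_side_unique:
  assumes "D \<subseteq> diagonals n" "noncrossing D"
    and "cyc p x y" "cyc p y q" "joined n D p x" "joined n D x y" "joined n D y q"
    and "cyc p x' y'" "cyc p y' q" "joined n D p x'" "joined n D x' y'" "joined n D y' q"
  shows "x = x'" "y = y'"
proof -
  note j = assms(5-7,10-12)
  have ni: "\<not> interleaved a b c d" if "joined n D a b" "joined n D c d" for a b c d
    using joined_not_interleaved assms(1,2) that by blast
  note ps = j[THEN joined_bounds(3)[OF _ assms(1)]]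
  have "\<not> interleaved x y p x'" "\<not> interleaved x' y' p x" "\<not> interleaved y q p x'" 
    "\<not> interleaved y' q p x" "\<not> interleaved x y y' q" "\<not> interleaved x' y' y q"
    using ni j by blast+
  moreover have "x \<noteq> y'" "x' \<noteq> y" using ps by blast+
  ultimately show "x = x'" "y = y'"
    using assms(3,4,8,9) unfolding interleaved_def
    by (smt (verit) cyclic_order)+
qed

section \<open>Regions of a dissected polygon\<close>

lemma turn_sub_arc:
  assumes "p < M" "u < M" "v < M" "q < M" "cyc p u v" "cyc p v q"
  shows "turn M p u < turn M p q" "turn M u v < turn M p q" "turn M v q < turn M p q"
  using assms unfolding turn_def cyc_def by (auto split: if_splits)

lemma vertex_in_gap:
  assumes "cyc s t u" "cyc s u v" "w \<notin> {s, t, u, v}"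
  shows "\<exists>(x, y)\<in>{(s, t), (t, u), (u, v), (v, s)}. cyc x w y"
proof -
  have w: "w \<noteq> s" "w \<noteq> t" "w \<noteq> u" "w \<noteq> v" "s \<noteq> u" "s \<noteq> t" "u \<noteq> v"
    using assms by auto
  have "cyc s w u \<or> cyc u w s" using cyc_total[of s w u] cyc_rotate[of s u w] w by blast
  then show ?thesis
  proof
    assume "cyc s w u"
    moreover have "cyc s w t \<or> cyc s t w" using cyc_total[of s w t] w by blast
    ultimately have "cyc s w t \<or> cyc t w u" using cyc_trans' by blast
    then show ?thesis by blast
  next
    assume "cyc u w s"
    moreover have "cyc u w v \<or> cyc u v w" using cyc_total[of u w v] w by blast
    ultimately have "cyc u w v \<or> cyc v w s" using cyc_trans' by blast
    then show ?thesis by blast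
  qed
qed

text \<open>
  An end that is not a vertex of the quadrilateral lies in the gap behind one of the sides, and
  the chord stays there; two vertices that are not opposite are the ends of a side.
\<close>

lemma chord_beside_square:
  assumes "cyc a b c" "cyc a c d" "x \<noteq> y" "{x, y} \<noteq> {a, c}" "{x, y} \<noteq> {b, d}"
    and ni: "\<not> interleaved a b x y" "\<not> interleaved b c x y" "\<not> interleaved c d x y"
      "\<not> interleaved d a x y"
  shows "\<exists>(u, v)\<in>{(a, b), (b, c), (c, d), (d, a)}. \<not> cyc u v x \<and> \<not> cyc u v y"
proof -
  have gap: ?thesis if z: "z \<notin> {a, b, c, d}" "(z, z') = (x, y) \<or> (z, z') = (y, x)" for z z'
  proof -
    obtain u v where uv: "(u, v) \<in> {(a, b), (b, c), (c, d), (d, a)}" "cyc u z v"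
      using vertex_in_gap[OF assms(1,2) z(1)] by blast
    have "\<not> interleaved u v z z'" using uv(1) ni interleaved_flip(2) z(2) by blast
    then have "\<not> cyc u v z'" using uv(2) cyc_rotate[of u v z'] unfolding interleaved_def by blast
    moreover have "\<not> cyc u v z" using uv(2) cyc_asym by blast
    ultimately show ?thesis using uv(1) z(2) by blast
  qed
  show ?thesis
  proof (cases "x \<in> {a, b, c, d} \<and> y \<in> {a, b, c, d}")
    case True
    then have "(x, y) \<in> {(a, b), (b, c), (c, d), (d, a)} \<or>
      (y, x) \<in> {(a, b), (b, c), (c, d), (d, a)}"
      using assms(3-5) by (auto simp: doubleton_eq_iff)
    then show ?thesis by auto
  next
    case False
    then show ?thesis using gap[of x y] gap[of y x] by blast
  qed
qed

locale even_polygon = inscribed_polygon p "2 * n + 2" for p :: "nat \<Rightarrow> complex" and n :: nat +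
  assumes n_pos: "1 \<le> n"
begin

abbreviation polygon_interior :: "complex set" where
  "polygon_interior \<equiv> interior (convex hull (p ` {..<2 * n + 2}))"

abbreviation cut_polygon :: "edge set \<Rightarrow> complex set" where
  "cut_polygon D \<equiv> polygon_interior - (\<Union>e\<in>D. chord p e)"

lemma next_vertex_neq: "a < 2 * n + 2 \<Longrightarrow> next_vertex n a \<noteq> a"
  using n_pos by (auto simp: next_vertex_if)

lemma polygon_interior_right:
  assumes "z \<in> polygon_interior" "a < 2 * n + 2"
  shows "orient (p a) (p (next_vertex n a)) z < 0"
proof (rule interior_hull_right_half_plane[OF _ _ assms(1)])
  show "p a \<noteq> p (next_vertex n a)"
    using distinct assms(2) next_vertex_less next_vertex_neq by metis
  show "orient (p a) (p (next_vertex n a)) x \<le> 0" if x: "x \<in> p ` {..<2 * n + 2}" for x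
  proof -
    obtain c where c: "c < 2 * n + 2" "x = p c" using x by auto
    then have "\<not> cyc (next_vertex n a) a c"
      using not_cyc_next_vertex[OF assms(2) c(1)] cyc_rotate[of _ a c] by blast
    then show ?thesis
      using orient_pos_iff[OF assms(2) next_vertex_less[of n a] c(1)] c(2)
      by (metis not_le_imp_less)
  qed
qed

lemma polygon_interior_in_disc:
  assumes "z \<in> polygon_interior"
  shows "cmod z < 1"
proof -
  have "convex hull (p ` {..<2 * n + 2}) \<subseteq> cball 0 1"
    by (rule hull_minimal) (auto simp: unit)
  then have "z \<in> interior (cball 0 1)" using assms interior_mono by blast
  then show ?thesis by simp
qed

lemma quadrilateral_in_polygon:
  assumes "a < 2 * n + 2" "b < 2 * n + 2" "c < 2 * n + 2" "d < 2 * n + 2"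
  shows "quadrilateral a b c d \<subseteq> polygon_interior"
  unfolding quadrilateral_def by (intro interior_mono hull_mono) (use assms in auto)

lemma diagonal_in_polygon:
  assumes "s < 2 * n + 2" "t < 2 * n + 2" "s \<noteq> t" "t \<noteq> next_vertex n s" "s \<noteq> next_vertex n t"
  shows "open_segment (p s) (p t) \<subseteq> polygon_interior"
proof -
  have "cyc s (next_vertex n s) t" "cyc s t (next_vertex n t)"
    using cyc_next_vertex[of s n t] cyc_next_vertex[of t n s] assms cyc_rotate by metis+
  then show ?thesis
    using diagonal_in_quadrilateral[of s "next_vertex n s" t "next_vertex n t"]
      quadrilateral_in_polygon assms next_vertex_less by blast
qed

lemma crosses_iff_interleaved:
  assumes "e \<in> edges n" "f \<in> edges n" "e \<noteq> f"
  shows "crosses p e p f \<longleftrightarrow> interleaved (fst e) (snd e) (fst f) (snd f)"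
proof -
  have "{fst e, snd e} \<noteq> {fst f, snd f}" "fst e \<noteq> snd e" "fst f \<noteq> snd f"
    using assms by (auto simp: edges_def doubleton_eq_iff)
  then show ?thesis
    unfolding crosses_def chord_def
    using segments_meet_iff_interleaved edgesD[OF assms(1)] edgesD[OF assms(2)] by blast
qed

lemma noncrossing_iff:
  assumes "D \<subseteq> edges n"
  shows "pairwise (\<lambda>e f. \<not> crosses p e p f) D \<longleftrightarrow> noncrossing D"
  unfolding pairwise_def noncrossing_def
  using crosses_iff_interleaved assms not_interleaved_refl by (metis subsetD)

text \<open>
  The first chord lies on a line, and the second one runs along that line only if both its ends
  do.
\<close>

lemma common_point_unique:
  assumes "a < 2 * n + 2" "b < 2 * n + 2" "c < 2 * n + 2" "d < 2 * n + 2" "a \<noteq> b" "c \<noteq> d"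
    "{a, b} \<noteq> {c, d}"
    and "z \<in> open_segment (p a) (p b)" "z \<in> open_segment (p c) (p d)"
    and "z' \<in> open_segment (p a) (p b)" "z' \<in> open_segment (p c) (p d)"
  shows "z = z'"
proof -
  have zero: "orient (p a) (p b) z = 0" if "z \<in> open_segment (p a) (p b)" for z
    using that by (auto simp: in_segment orient_affine)
  obtain t t' where t: "z = (1 - t) *\<^sub>R p c + t *\<^sub>R p d" "z' = (1 - t') *\<^sub>R p c + t' *\<^sub>R p d"
    using assms(9,11) by (auto simp: in_segment)
  define u v where "u = orient (p a) (p b) (p c)" and "v = orient (p a) (p b) (p d)"
  have "(1 - t) * u + t * v = 0" "(1 - t') * u + t' * v = 0"
    using zero[OF assms(8)] zero[OF assms(10)] by (simp_all add: t orient_affine u_def v_def)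
  then have tt: "(t - t') * (v - u) = 0" by algebra
  have "v \<noteq> u"
  proof
    assume "v = u"
    then have "u = 0" "v = 0" using \<open>(1 - t) * u + t * v = 0\<close> by (simp_all add: algebra_simps)
    then have "\<not> cyc a b c" "\<not> cyc b a c" "\<not> cyc a b d" "\<not> cyc b a d"
      using orient_neg_iff[of a b c] orient_pos_iff[of a b c] orient_neg_iff[of a b d]
        orient_pos_iff[of a b d] assms(1-4) by (auto simp: u_def v_def)
    then have "c \<in> {a, b}" "d \<in> {a, b}"
      using assms(5) cyc_total[of b a c] cyc_rotate[of b c a] cyc_rotate[of c a b]
        cyc_total[of b a d] cyc_rotate[of b d a] cyc_rotate[of d a b] by blast+
    then show False using assms(6,7) by auto
  qed
  then show ?thesis using tt t by simp
qed

text \<open>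
  A side of a region that is a quadrilateral has to be an edge. A point of the side on no chord of
  \<open>D\<close> would belong to the cut polygon and to the closure of the region. But a component is
  relatively closed, so the point would lie in the region, which is open and to the right of the
  side. Hence the infinitely many points of the side are covered by finitely many chords of \<open>D\<close>,
  each of which has at most one point in common with it.
\<close>

lemma side_of_region:
  assumes "D \<subseteq> diagonals n"
    and "s < 2 * n + 2" "t < 2 * n + 2" "u < 2 * n + 2" "v < 2 * n + 2" "cyc s t u" "cyc s u v"
    and "quadrilateral s t u v \<in> regions n p D"
  shows "joined n D s t"
proof (rule ccontr)
  assume nj: "\<not> joined n D s t"
  let ?R = "quadrilateral s t u v"
  have R: "?R \<in> components (cut_polygon D)" using assms(8) by (simp add: regions_def)
  have st: "s \<noteq> t" using assms(6) by auto
  have "t \<noteq> next_vertex n s" "s \<noteq> next_vertex n t"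
    using nj joined_next_vertex joined_sym assms(2,3) by metis+
  then have inP: "open_segment (p s) (p t) \<subseteq> polygon_interior"
    using diagonal_in_polygon assms(2,3) st by blast
  have covered: "open_segment (p s) (p t) \<subseteq> (\<Union>e\<in>D. chord p e)"
  proof (rule ccontr)
    assume "\<not> ?thesis"
    then obtain z where z: "z \<in> open_segment (p s) (p t)" "z \<in> cut_polygon D" using inP by blast
    have "?R \<noteq> {}" using R in_components_nonempty by blast
    then have "closure ?R = closure (convex hull {p s, p t, p u, p v})"
      unfolding quadrilateral_def by (intro convex_closure_interior) auto
    moreover have "z \<in> convex hull {p s, p t}"
      using z(1) open_closed_segment by (auto simp: segment_convex_hull)
    then have "z \<in> convex hull {p s, p t, p u, p v}"
      using hull_mono[of "{p s, p t}" "{p s, p t, p u, p v}" convex] by auto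
    ultimately have "z \<in> closure ?R" using closure_subset by blast
    moreover have "closedin (top_of_set (cut_polygon D)) ?R" using closedin_component[OF R] .
    then obtain T where "closed T" "?R = cut_polygon D \<inter> T" by (auto simp: closedin_closed)
    ultimately have "z \<in> ?R" using z(2) closure_minimal[of ?R T] by blast
    then have "orient (p s) (p t) z < 0" using quadrilateral_eq assms(2-7) by blast
    moreover have "orient (p s) (p t) z = 0" using z(1) by (auto simp: in_segment orient_affine)
    ultimately show False by simp
  qed
  have "finite D"
    by (rule finite_subset[of _ "{..<2 * n + 2} \<times> {..<2 * n + 2}"])
      (use assms(1) in \<open>auto simp: diagonals_def edges_def\<close>)
  moreover have "finite (chord p e \<inter> open_segment (p s) (p t))" if "e \<in> D" for e
  proof -
    have e: "e \<in> edges n" using that assms(1) diagonals_edges by blast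
    have "{fst e, snd e} \<noteq> {s, t}" "fst e \<noteq> snd e"
      using nj that edgesD[OF e] by (auto simp: joined_def doubleton_eq_iff)
    then have "z = z'" if "z \<in> chord p e \<inter> open_segment (p s) (p t)"
      "z' \<in> chord p e \<inter> open_segment (p s) (p t)" for z z'
      using common_point_unique[of "fst e" "snd e" s t z z'] edgesD[OF e] assms(2,3) st that
      unfolding chord_def by blast
    then have "\<exists>z. chord p e \<inter> open_segment (p s) (p t) \<subseteq> {z}" by blast
    then show ?thesis using finite_subset by blast
  qed
  ultimately have "finite (\<Union>e\<in>D. chord p e \<inter> open_segment (p s) (p t))" by blast
  moreover have "(\<Union>e\<in>D. chord p e \<inter> open_segment (p s) (p t)) = open_segment (p s) (p t)"
    using covered by blast
  ultimately have "finite (open_segment (p s) (p t))" by simp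
  then show False using distinct assms(2,3) st finite_open_segment by blast
qed

lemma orient_side_nonzero:
  assumes "joined n D u v" "D \<subseteq> diagonals n" "z \<in> cut_polygon D"
  shows "orient (p u) (p v) z \<noteq> 0"
proof -
  note uv = joined_bounds[OF assms(1,2)] joined_neq[OF assms(1,2)]
  consider "(u, v) \<in> D" | "(v, u) \<in> D" | "v = next_vertex n u" | "u = next_vertex n v"
    using assms(1) unfolding joined_def by (auto simp: boundary_iff)
  note cases = this
  have off: "orient (p u) (p v) z \<noteq> 0" if "z \<notin> open_segment (p u) (p v)"
    using on_chord_of_disc[of "p u" "p v" z] unit uv(1,2) distinct[OF uv(1,2,4)]
      polygon_interior_in_disc assms(3) that by blast
  show ?thesis
  proof (rule cases)
    assume "(u, v) \<in> D"
    then have "z \<notin> open_segment (p u) (p v)" using assms(3) by (force simp: chord_def)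
    then show ?thesis by (rule off)
  next
    assume "(v, u) \<in> D"
    then have "z \<notin> open_segment (p u) (p v)"
      using assms(3) by (force simp: chord_def open_segment_commute)
    then show ?thesis by (rule off)
  next
    assume "v = next_vertex n u"
    then show ?thesis using polygon_interior_right uv(1) assms(3) by force
  next
    assume "u = next_vertex n v"
    then have "orient (p v) (p u) z < 0" using polygon_interior_right uv(2) assms(3) by force
    then show ?thesis using orient_swap[of "p v" "p u" z] by simp
  qed
qed

text \<open>
  No chord of \<open>D\<close> enters the quadrilateral, because every such chord lies behind one of its sides or
  is a side; a diagonal of the quadrilateral joins vertices of the same colour. The boundary of
  the quadrilateral is made of edges, so within the cut polygon the quadrilateral is not only open
  and connected, but closed, too: it is a component.
\<close>

lemma square_is_region:
  assumes D: "D \<subseteq> diagonals n" "noncrossing D"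
    and cyc: "cyc a b c" "cyc a c d"
    and j: "joined n D a b" "joined n D b c" "joined n D c d" "joined n D d a"
  shows "quadrilateral a b c d \<in> regions n p D"
proof -
  let ?R = "quadrilateral a b c d" and ?U = "cut_polygon D"
  note lt = j[THEN joined_bounds(1)[OF _ D(1)]]
  note eq = quadrilateral_eq[OF lt cyc]
  have disj: "?R \<inter> chord p e = {}" if "e \<in> D" for e
  proof (rule ccontr)
    assume "?R \<inter> chord p e \<noteq> {}"
    then obtain z where z: "z \<in> ?R" "z \<in> chord p e" by blast
    obtain x y where e: "e = (x, y)" by (cases e)
    have xy: "x < 2 * n + 2" "y < 2 * n + 2" "even x" "odd y"
      using that D(1) diagonals_edges edgesD[of e n] e by auto
    have je: "joined n D x y" using that e by (simp add: joined_def)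
    have "even a \<longleftrightarrow> even c" "even b \<longleftrightarrow> even d"
      using j[THEN joined_bounds(3)[OF _ D(1)]] by blast+
    then have "{x, y} \<noteq> {a, c}" "{x, y} \<noteq> {b, d}" "x \<noteq> y"
      using xy by (auto simp: doubleton_eq_iff)
    then obtain u v where uv: "(u, v) \<in> {(a, b), (b, c), (c, d), (d, a)}" "\<not> cyc u v x"
      "\<not> cyc u v y"
      using chord_beside_square[OF cyc, of x y] joined_not_interleaved[OF D _ je] j by blast
    have "u < 2 * n + 2" "v < 2 * n + 2" using uv(1) lt by auto
    then have "orient (p v) (p u) (p x) \<le> 0" "orient (p v) (p u) (p y) \<le> 0"
      using orient_pos_iff[of v u] uv(2,3) xy by (simp_all flip: not_less)
    then have "orient (p v) (p u) z \<le> 0"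
      using orient_segment_sign(1)[of z "p x" "p y"] z(2) by (simp add: chord_def e)
    moreover have "orient (p u) (p v) z < 0" using uv(1) z(1) eq by auto
    ultimately show False using orient_swap[of "p u" "p v" z] by simp
  qed
  have sub: "?R \<subseteq> ?U" using disj quadrilateral_in_polygon[OF lt] by blast
  have "p a \<noteq> p c" using distinct lt cyc(2) cyc_distinct by blast
  then have "?R \<noteq> {}"
    using diagonal_in_quadrilateral[OF lt cyc] by (metis open_segment_eq_empty subset_empty)
  have conn: "connected ?R"
    unfolding quadrilateral_def by (intro convex_connected convex_interior convex_convex_hull)
  then obtain C where C: "C \<in> components ?U" "?R \<subseteq> C"
    using exists_component_superset[of ?R ?U] sub \<open>?R \<noteq> {}\<close> by blast
  \<comment> \<open>A component that leaves the quadrilateral would contain a point of one of its sides.\<close>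
  have "C \<subseteq> ?R"
  proof (rule ccontr)
    assume "\<not> C \<subseteq> ?R"
    then have "C \<inter> frontier ?R \<noteq> {}"
      using connected_Int_frontier[of C ?R] C \<open>?R \<noteq> {}\<close> in_components_connected by blast
    then obtain w where w: "w \<in> C" "w \<in> closure ?R" "w \<notin> ?R"
      by (auto simp: frontier_def quadrilateral_def)
    have "w \<in> ?U" using w(1) C(1) in_components_subset by blast
    have le: "orient (p x) (p y) w \<le> 0" if "\<And>z. z \<in> ?R \<Longrightarrow> orient (p x) (p y) z < 0" for x y
      using closure_minimal[of ?R "{z. orient (p x) (p y) z \<le> 0}"] closed_right_half_plane(2)
        that w(2)
      by (force simp: less_imp_le)
    have "orient (p a) (p b) w \<le> 0" "orient (p b) (p c) w \<le> 0" "orient (p c) (p d) w \<le> 0"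
      "orient (p d) (p a) w \<le> 0"
      by (rule le, simp add: eq)+
    moreover have "orient (p x) (p y) w \<noteq> 0" if "joined n D x y" for x y
      using orient_side_nonzero[OF that D(1) \<open>w \<in> ?U\<close>] .
    ultimately have "w \<in> ?R" using j unfolding eq by (simp add: less_le)
    then show False using w(3) by simp
  qed
  then show ?thesis using C by (simp add: regions_def subset_antisym)
qed

text \<open>
  Among the edges, taken with a direction, that have \<open>z\<close> strictly on their left, take one that cuts
  off the shortest arc. The other three sides of the square behind it cut off shorter arcs, so \<open>z\<close>
  is on their right and therefore inside the square.
\<close>

lemma in_some_square:
  assumes "maximal_noncrossing n D" "z \<in> cut_polygon D"
  obtains a b c d where "cyc a b c" "cyc a c d"
    "joined n D a b" "joined n D b c" "joined n D c d" "joined n D d a" "z \<in> quadrilateral a b c d"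
proof -
  have D: "D \<subseteq> diagonals n" "noncrossing D" using assms(1) by (auto simp: maximal_noncrossing_def)
  define cap where "cap = (\<lambda>(x, y). joined n D x y \<and> orient (p x) (p y) z > 0)"
  \<comment> \<open>Read from vertex 1 to vertex 0, the first side has the whole polygon on its left.\<close>
  have "cap (next_vertex n 0, 0)"
    using joined_next_vertex[of 0 n D] joined_sym polygon_interior_right[of z 0] assms(2)
      orient_swap[of "p 0" "p (next_vertex n 0)" z] by (simp add: cap_def)
  then obtain e where e: "cap e"
    "\<forall>e'. cap e' \<longrightarrow> turn (2 * n + 2) (fst e) (snd e) \<le> turn (2 * n + 2) (fst e') (snd e')"
    using ex_has_least_nat[of cap _ "\<lambda>e. turn (2 * n + 2) (fst e) (snd e)"] by blast
  define x y where "x = fst e" and "y = snd e"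
  have xy: "cap (x, y)" using e(1) by (simp add: x_def y_def)
  have min: "turn (2 * n + 2) x y \<le> turn (2 * n + 2) x' y'" if "cap (x', y')" for x' y'
    using e(2) that by (force simp: x_def y_def)
  have jxy: "joined n D x y" and pos: "orient (p x) (p y) z > 0" using xy by (auto simp: cap_def)
  note lt = joined_bounds(1,2)[OF jxy D(1)]
  have "y \<noteq> next_vertex n x" using polygon_interior_right[of z x] assms(2) lt pos by force
  then obtain u v where uv: "u < 2 * n + 2" "v < 2 * n + 2" "cyc x u v" "cyc x v y"
    "joined n D x u" "joined n D u v" "joined n D v y"
    using square_on_side[OF assms(1) jxy] by blast
  have neg: "orient (p x') (p y') z < 0"
    if "joined n D x' y'" "turn (2 * n + 2) x' y' < turn (2 * n + 2) x y" for x' y'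
    using that min[of x' y'] orient_side_nonzero[OF that(1) D(1) assms(2)]
    by (fastforce simp: cap_def)
  note arcs = turn_sub_arc[OF lt(1) uv(1,2) lt(2) uv(3,4)]
  have "orient (p x) (p u) z < 0" "orient (p u) (p v) z < 0" "orient (p v) (p y) z < 0"
    using neg uv arcs by blast+
  moreover have "orient (p y) (p x) z < 0" using pos orient_swap[of "p x" "p y" z] by simp
  ultimately have "z \<in> quadrilateral x u v y"
    using quadrilateral_eq[OF lt(1) uv(1,2) lt(2) uv(3,4)] by blast
  then show ?thesis using that uv jxy joined_sym by blast
qed

lemma square_in_squares:
  assumes D: "D \<subseteq> diagonals n" "noncrossing D"
    and cyc: "cyc a b c" "cyc a c d"
    and j: "joined n D a b" "joined n D b c" "joined n D c d" "joined n D d a"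
  shows "{a, b, c, d} \<in> squares n p D"
proof -
  note lt = j[THEN joined_bounds(1)[OF _ D(1)]]
  have "card {a, b, c, d} = 4" using cyc by (auto simp: cyc_def)
  then show ?thesis
    using square_is_region[OF assms] lt by (simp add: squares_def quadrilateral_def)
qed

lemma squaresE:
  assumes "S \<in> squares n p D" "D \<subseteq> diagonals n"
  obtains a b c d where "S = {a, b, c, d}" "a < b" "b < c" "c < d"
    "joined n D a b" "joined n D b c" "joined n D c d" "joined n D d a"
    "interior (convex hull (p ` S)) = quadrilateral a b c d" "quadrilateral a b c d \<in> regions n p D"
proof -
  have S: "S \<subseteq> {..<2 * n + 2}" "card S = 4" "interior (convex hull (p ` S)) \<in> regions n p D"
    using assms(1) by (auto simp: squares_def)
  have fin: "finite S" using S(2) card.infinite by fastforce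
  define l where "l = sorted_list_of_set S"
  have "length l = 4" using S(2) by (simp add: l_def)
  then obtain a b c d where abcd: "l = [a, b, c, d]"
    by (auto simp: numeral_eq_Suc length_Suc_conv)
  have "sorted_wrt (<) l" "set l = S" using fin by (simp_all add: l_def)
  then have ord: "a < b" "b < c" "c < d" and Seq: "S = {a, b, c, d}" by (auto simp: abcd)
  have q: "interior (convex hull (p ` S)) = quadrilateral a b c d"
    by (simp add: Seq quadrilateral_def)
  have rot: "quadrilateral a b c d = quadrilateral b c d a"
    "quadrilateral a b c d = quadrilateral c d a b"
    "quadrilateral a b c d = quadrilateral d a b c"
    by (simp_all add: quadrilateral_def insert_commute)
  have lt: "a < 2 * n + 2" "b < 2 * n + 2" "c < 2 * n + 2" "d < 2 * n + 2" using S(1) Seq by auto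
  have "joined n D a b" "joined n D b c" "joined n D c d" "joined n D d a"
    using side_of_region[OF assms(2), of a b c d] side_of_region[OF assms(2), of b c d a]
      side_of_region[OF assms(2), of c d a b] side_of_region[OF assms(2), of d a b c]
      lt ord S(3) q rot by (auto simp: cyc_def)
  then show ?thesis using that Seq ord q S(3) by metis
qed

text \<open>
  If every region is a square, a further diagonal that crosses nothing would lie in one of the
  squares with both ends among its vertices. The sides of the square join different colours, so
  this diagonal would be a side, which does not meet the open square. Conversely, a maximal
  noncrossing set has a square around each point of the cut polygon, and these squares are
  regions.
\<close>

theorem quadrangulation_iff: "quadrangulation n p D \<longleftrightarrow> maximal_noncrossing n D"
proof
  assume max: "maximal_noncrossing n D"
  then have D: "D \<subseteq> diagonals n" "noncrossing D" by (auto simp: maximal_noncrossing_def)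
  have "\<exists>S\<in>squares n p D. R = interior (convex hull (p ` S))" if R: "R \<in> regions n p D" for R
  proof -
    have Rc: "R \<in> components (cut_polygon D)" using R by (simp add: regions_def)
    obtain z where z: "z \<in> R" "z \<in> cut_polygon D"
      using in_components_nonempty[OF Rc] in_components_subset[OF Rc] by blast
    then obtain a b c d where q: "cyc a b c" "cyc a c d"
      "joined n D a b" "joined n D b c" "joined n D c d" "joined n D d a"
        "z \<in> quadrilateral a b c d"
      using in_some_square[OF max] by blast
    have "quadrilateral a b c d \<in> components (cut_polygon D)"
      using square_is_region[OF D q(1-6)] by (simp add: regions_def)
    then have "R = quadrilateral a b c d"
      using Rc z(1) q(7) components_eq[of R _ "quadrilateral a b c d"] by blast
    then show ?thesis
      by (intro bexI[OF _ square_in_squares[OF D q(1-6)]]) (simp add: quadrilateral_def)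
  qed
  then show "quadrangulation n p D"
    using D noncrossing_iff[OF subset_trans[OF D(1) diagonals_edges]]
    by (simp add: quadrangulation_def)
next
  assume quad: "quadrangulation n p D"
  then have D: "D \<subseteq> diagonals n" by (simp add: quadrangulation_def)
  have nc: "noncrossing D" 
    using quad noncrossing_iff[OF subset_trans[OF D diagonals_edges]]
    by (simp add: quadrangulation_def)
  have "\<exists>f\<in>D. interleaved (fst e) (snd e) (fst f) (snd f)" if e: "e \<in> diagonals n - D" for e
  proof (rule ccontr)
    assume no: "\<not> ?thesis"
    obtain w b where wb: "e = (w, b)" by (cases e)
    have ee: "e \<in> edges n" using e diagonals_edges by blast
    have lt: "w < 2 * n + 2" "b < 2 * n + 2" "even w" "odd b" using edgesD[OF ee] wb by auto
    have "b \<noteq> next_vertex n w" "w \<noteq> next_vertex n b" "w \<noteq> b"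
      using e wb ee lt by (auto simp: diagonals_def boundary_iff)
    then have "chord p e \<subseteq> polygon_interior"
      using diagonal_in_polygon[OF lt(1,2)] by (simp add: chord_def wb)
    moreover have "chord p e \<inter> chord p f = {}" if "f \<in> D" for f
      using crosses_iff_interleaved[OF ee, of f] no that e D diagonals_edges
      unfolding crosses_def by blast
    ultimately have "chord p e \<subseteq> cut_polygon D" by blast
    moreover have pne: "p w \<noteq> p b" using distinct lt \<open>w \<noteq> b\<close> by blast
    then have ne: "chord p e \<noteq> {}" by (simp add: chord_def wb)
    moreover have "connected (chord p e)"
      unfolding chord_def by (intro convex_connected convex_open_segment)
    ultimately obtain R where R: "R \<in> regions n p D" "chord p e \<subseteq> R"
      using exists_component_superset[of "chord p e" "cut_polygon D"] unfolding regions_def by blast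
    obtain S where S: "S \<in> squares n p D" "R = interior (convex hull (p ` S))"
      using quad R(1) by (auto simp: quadrangulation_def)
    obtain s t u v where q: "S = {s, t, u, v}" "s < t" "t < u" "u < v"
      and j: "joined n D s t" "joined n D t u" "joined n D u v" "joined n D v s"
      and Rq: "interior (convex hull (p ` S)) = quadrilateral s t u v"
      using squaresE[OF S(1) D] by metis
    have cyc: "cyc s t u" "cyc s u v" using q by (auto simp: cyc_def)
    note ltq = j[THEN joined_bounds(1)[OF _ D]]
    note eq = quadrilateral_eq[OF ltq cyc]
    have neg: "orient (p x) (p y) z < 0"
      if "(x, y) \<in> {(s, t), (t, u), (u, v), (v, s)}" "z \<in> chord p e" for x y z
    proof -
      have "z \<in> quadrilateral s t u v" using that(2) R(2) S(2) Rq by blast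
      then show ?thesis using that(1) eq by auto
    qed
    \<comment> \<open>An end that is not a corner lies behind a side, but it is a limit of points of the chord.\<close>
    have corner: "x \<in> {s, t, u, v}" if x: "x = w \<or> x = b" for x
    proof (rule ccontr)
      assume "x \<notin> {s, t, u, v}"
      then obtain y y' where y: "(y, y') \<in> {(s, t), (t, u), (u, v), (v, s)}" "cyc y x y'"
        using vertex_in_gap[OF cyc] by blast
      have "closure (chord p e) \<subseteq> {z. orient (p y) (p y') z \<le> 0}"
        using neg[OF y(1)] closed_right_half_plane(2)
        by (intro closure_minimal) (auto simp: less_imp_le)
      moreover have "p x \<in> closure (chord p e)"
        using x pne by (auto simp: chord_def wb closure_open_segment)
      ultimately have "orient (p y) (p y') (p x) \<le> 0" by blast
      moreover have "orient (p y) (p y') (p x) > 0"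
        using orient_pos_iff[of y y' x] y ltq lt x cyc_rotate[of y x y'] cyc_rotate[of x y' y]
        by auto
      ultimately show False by simp
    qed
    have "even s \<longleftrightarrow> odd t" "even t \<longleftrightarrow> odd u" "even u \<longleftrightarrow> odd v" "even v \<longleftrightarrow> odd s"
      using j[THEN joined_bounds(3)[OF _ D]] by blast+
    then obtain x y where "(x, y) \<in> {(s, t), (t, u), (u, v), (v, s)}"
      "(x, y) = (w, b) \<or> (x, y) = (b, w)"
      using corner[of w] corner[of b] lt(3,4) by auto
    moreover obtain z where z: "z \<in> chord p e" using ne by blast
    then have "orient (p w) (p b) z = 0" by (auto simp: chord_def wb in_segment orient_affine)
    ultimately show False using neg[OF _ z, of x y] orient_swap[of "p w" "p b" z] by auto
  qed
  then show "maximal_noncrossing n D" using D nc by (simp add: maximal_noncrossing_def)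
qed

end

section \<open>Crossings of red edges with a blue edge\<close>

lemma blue_vert: "blue n i = vert (4 * n + 4) (2 * i)"
proof -
  have "2 * pi * real i / real (2 * n + 2) = 2 * pi * real (2 * i) / real (4 * n + 4)"
    by (subst frac_eq_eq) (simp_all add: algebra_simps)
  then show ?thesis unfolding blue_def vert_def by (simp only:)
qed

lemma red_vert: "red n i = vert (4 * n + 4) (2 * i + 1)"
proof -
  have angle: "2 * pi * real (2 * i + 1) = 2 * pi + 2 * pi * real (2 * i)"
    by (simp add: algebra_simps)
  show ?thesis
    unfolding red_def blue_vert vert_def cis_mult angle add_divide_distrib minus_add_distrib ..
qed

lemma cyc_double: "cyc (2 * a + 1) (2 * b + 1) (2 * c + 1) = cyc a b c"
  "cyc (2 * a) (2 * b) (2 * c) = cyc a b c"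
  by (auto simp: cyc_def)

lemma even_polygon_vert:
  assumes "1 \<le> n" "k \<le> 1"
  shows "even_polygon (\<lambda>i. vert (4 * n + 4) (2 * i + k)) n"
proof -
  interpret V: inscribed_polygon "vert (4 * n + 4)" "4 * n + 4" by (rule inscribed_vert) simp
  show ?thesis
  proof
    show "cmod (vert (4 * n + 4) (2 * i + k)) = 1" if "i < 2 * n + 2" for i
      using that assms(2) by (intro V.unit) simp
    show "orient (vert (4 * n + 4) (2 * a + k)) (vert (4 * n + 4) (2 * b + k)) (vert (4 * n + 4) (2 * c + k)) < 0"
      if "a < 2 * n + 2" "b < 2 * n + 2" "c < 2 * n + 2" "cyc a b c" for a b c
      using that assms(2) by (intro V.clockwise) (auto simp: cyc_def)
    show "vert (4 * n + 4) (2 * a + k) \<noteq> vert (4 * n + 4) (2 * b + k)"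
      if "a < 2 * n + 2" "b < 2 * n + 2" "a \<noteq> b" for a b
      using that assms(2) by (intro V.distinct) auto
  qed (rule assms(1))
qed

lemma even_polygon_blue: "1 \<le> n \<Longrightarrow> even_polygon (blue n) n"
  using even_polygon_vert[of n 0] by (simp add: blue_vert[abs_def])

lemma even_polygon_red: "1 \<le> n \<Longrightarrow> even_polygon (red n) n"
  using even_polygon_vert[of n 1] by (simp add: red_vert[abs_def])

text \<open>
  The red vertex \<open>x\<close> lies on the arc that leads clockwise from the white end of the blue edge \<open>l\<close> to
  its black end, that is, to the left of \<open>l\<close>. The factor 2 places the blue and the red vertices
  alternately on the circle.
\<close>

definition west :: "edge \<Rightarrow> nat \<Rightarrow> bool" where
  "west l x \<longleftrightarrow> cyc (2 * fst l) (2 * x + 1) (2 * snd l)"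

text \<open>
  The edge crosses \<open>l\<close> in the compatible direction.
\<close>

definition passes :: "edge \<Rightarrow> edge \<Rightarrow> bool" where
  "passes e l \<longleftrightarrow> west l (fst e) \<and> \<not> west l (snd e)"

lemma not_west:
  assumes "l \<in> edges n"
  shows "\<not> west l x \<longleftrightarrow> cyc (2 * snd l) (2 * x + 1) (2 * fst l)"
proof -
  have "fst l \<noteq> snd l" using edgesD[OF assms] by auto
  then have "2 * fst l \<noteq> 2 * x + 1" "2 * x + 1 \<noteq> 2 * snd l" "2 * fst l \<noteq> 2 * snd l"
    by presburger+
  then show ?thesis unfolding west_def by (smt (verit) cyclic_order)
qed

lemma west_iff_turn:
  assumes "l \<in> edges n" "x < 2 * n + 2"
  shows "west l x \<longleftrightarrow> turn (2 * n + 2) (fst l) x < turn (2 * n + 2) (fst l) (snd l)"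
proof -
  have "fst l < 2 * n + 2" "snd l < 2 * n + 2" "fst l \<noteq> snd l"
    using edgesD[OF assms(1)] by auto
  then show ?thesis
    unfolding turn_less_iff[OF \<open>fst l < _\<close> assms(2) \<open>snd l < _\<close>] west_def cyc_def
    by (cases "fst l \<le> x"; cases "fst l < snd l"; cases "x < snd l") auto
qed

lemma crosses_iff_west:
  assumes "e \<in> edges n" "l \<in> edges n"
  shows "crosses (red n) e (blue n) l \<longleftrightarrow> (west l (fst e) \<longleftrightarrow> \<not> west l (snd e))"
proof -
  interpret V: inscribed_polygon "vert (4 * n + 4)" "4 * n + 4" by (rule inscribed_vert) simp
  note e = edgesD[OF assms(1)] and l = edgesD[OF assms(2)]
  have "2 * fst e + 1 \<noteq> 2 * snd e + 1" "2 * fst l \<noteq> 2 * snd l"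
    "2 * fst e + 1 \<notin> {2 * fst l, 2 * snd l}"
    using e l by (auto, presburger+)
  then have "crosses (red n) e (blue n) l \<longleftrightarrow>
      interleaved (2 * fst e + 1) (2 * snd e + 1) (2 * fst l) (2 * snd l)"
    unfolding crosses_def chord_def red_vert blue_vert
    using e l by (intro V.segments_meet_iff_interleaved) auto
  also have "\<dots> \<longleftrightarrow> interleaved (2 * fst l) (2 * snd l) (2 * fst e + 1) (2 * snd e + 1)"
    using interleaved_sym by blast
  also have "\<dots> \<longleftrightarrow> (west l (fst e) \<longleftrightarrow> \<not> west l (snd e))"
    unfolding interleaved_def not_west[OF assms(2), symmetric] west_def[symmetric] by blast
  finally show ?thesis .
qed

lemma positive_basis_orient:
  "positive_basis (b - a) (d - c) \<longleftrightarrow> orient a b c < orient a b d"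
  by (simp add: positive_basis_def orient_expand algebra_simps)

text \<open>
  When the two edges cross, the determinant of their directions is the area that the red edge
  spans with the black end of \<open>l\<close> minus the one that it spans with the white end, and these have
  opposite signs.
\<close>

lemma compatible_iff:
  assumes "e \<in> edges n" "l \<in> edges n"
  shows "compatible n e l \<longleftrightarrow> (west l (snd e) \<longrightarrow> west l (fst e))"
proof (cases "west l (fst e) \<longleftrightarrow> west l (snd e)")
  case True
  then show ?thesis using crosses_iff_west[OF assms] by (auto simp: compatible_def)
next
  case False
  interpret V: inscribed_polygon "vert (4 * n + 4)" "4 * n + 4" by (rule inscribed_vert) simp
  note e = edgesD[OF assms(1)] and l = edgesD[OF assms(2)]
  have bounds: "2 * fst e + 1 < 4 * n + 4" "2 * snd e + 1 < 4 * n + 4" "2 * fst l < 4 * n + 4"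
    "2 * snd l < 4 * n + 4" using e l by auto
  let ?w = "2 * fst e + 1" and ?b = "2 * snd e + 1" and ?w' = "2 * fst l" and ?b' = "2 * snd l"
  have c: "compatible n e l \<longleftrightarrow>
     orient (vert (4 * n + 4) ?w) (vert (4 * n + 4) ?b) (vert (4 * n + 4) ?w')
     < orient (vert (4 * n + 4) ?w) (vert (4 * n + 4) ?b) (vert (4 * n + 4) ?b')"
    using crosses_iff_west[OF assms] False
    unfolding compatible_def direction_def positive_basis_orient red_vert blue_vert by simp
  show ?thesis
  proof (cases "west l (fst e)")
    case True
    then have "cyc ?w' ?w ?b'" "cyc ?b' ?b ?w'"
      using False not_west[OF assms(2)] by (auto simp: west_def)
    then have "cyc ?b ?w ?b'" "cyc ?w ?b ?w'" by (smt (verit) cyclic_order)+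
    then show ?thesis
      using c V.orient_pos_iff[OF bounds(1,2,4)] V.orient_neg_iff[OF bounds(1,2,3)] True by simp
  next
    case False': False
    then have "cyc ?w' ?b ?b'" "cyc ?b' ?w ?w'"
      using False not_west[OF assms(2)] by (auto simp: west_def)
    then have "cyc ?w ?b ?b'" "cyc ?b ?w ?w'" by (smt (verit) cyclic_order)+
    then show ?thesis
      using c V.orient_pos_iff[OF bounds(1,2,3)] V.orient_neg_iff[OF bounds(1,2,4)] False False'
      by simp
  qed
qed

text \<open>
  Between two neighbouring vertices of one polygon there is exactly one vertex of the other.
\<close>

lemma between_neighbours:
  assumes "x < 2 * n + 2" "y < 2 * n + 2"
  shows "cyc (2 * x + 1) (2 * y) (2 * next_vertex n x + 1) \<Longrightarrow> y = next_vertex n x"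
    and "cyc (2 * x) (2 * y + 1) (2 * next_vertex n x) \<Longrightarrow> y = x"
  using assms unfolding next_vertex_if[OF assms(1)] cyc_def by (auto split: if_splits)

text \<open>
  An incompatible pair crosses so that the single vertex between the two ends of the boundary edge
  has the wrong colour.
\<close>

lemma boundary_compatible:
  assumes "e \<in> edges n" "l \<in> edges n" "e \<in> boundary n \<or> l \<in> boundary n"
  shows "compatible n e l"
proof (rule ccontr)
  assume "\<not> ?thesis"
  then have *: "cyc (2 * fst l) (2 * snd e + 1) (2 * snd l)"
    "cyc (2 * snd l) (2 * fst e + 1) (2 * fst l)"
    using compatible_iff[OF assms(1,2)] not_west[OF assms(2)] by (auto simp: west_def)
  note e = edgesD[OF assms(1)] and l = edgesD[OF assms(2)]
  consider "snd e = next_vertex n (fst e)" | "fst e = next_vertex n (snd e)"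
    | "snd l = next_vertex n (fst l)" | "fst l = next_vertex n (snd l)"
    using assms(3) boundary_iff[of "fst e" "snd e" n] boundary_iff[of "fst l" "snd l" n] by auto
  then show False
  proof cases
    case 1
    have "cyc (2 * fst e + 1) (2 * fst l) (2 * snd e + 1)" using * by (smt (verit) cyclic_order)
    then show False using between_neighbours(1)[of "fst e" n "fst l"] 1 e l by auto
  next
    case 2
    have "cyc (2 * snd e + 1) (2 * snd l) (2 * fst e + 1)" using * by (smt (verit) cyclic_order)
    then show False using between_neighbours(1)[of "snd e" n "snd l"] 2 e l by auto
  next
    case 3
    then show False using between_neighbours(2)[of "fst l" n "snd e"] * e l by auto
  next
    case 4
    then show False using between_neighbours(2)[of "snd l" n "fst e"] * e l by auto
  qed
qed

lemma chord_commute: "chord p (a, b) = chord p (b, a)"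
  by (simp add: chord_def open_segment_commute)

lemma passing_point:
  assumes "e \<in> edges n" "l \<in> edges n" "passes e l"
  obtains x where "0 < x" "x < 1" "linepath (blue n (fst l)) (blue n (snd l)) x \<in> chord (red n) e"
proof -
  have "crosses (red n) e (blue n) l"
    using crosses_iff_west[OF assms(1,2)] assms(3) by (auto simp: passes_def)
  then obtain z where z: "z \<in> chord (red n) e" "z \<in> open_segment (blue n (fst l)) (blue n (snd l))"
    unfolding crosses_def by (auto simp: chord_def[of "blue n"])
  then show ?thesis using that by (auto simp: in_segment linepath_def)
qed

text \<open>
  The function \<open>orient\<close> of the line through \<open>e\<close> is affine along \<open>l\<close>; it vanishes where \<open>l\<close> crosses \<open>e\<close>, and
  at the crossing with \<open>f\<close> it has the sign that it has at the black end of \<open>l\<close>.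
\<close>

lemma passing_order:
  assumes l: "l \<in> edges n" and e: "e \<in> edges n" "passes e l" and f: "f \<in> edges n" "passes f l"
    "e \<noteq> f"
    and "turn (2 * n + 2) (fst l) (fst e) \<le> turn (2 * n + 2) (fst l) (fst f)"
    and "turn (2 * n + 2) (fst l) (snd e) \<ge> turn (2 * n + 2) (fst l) (snd f)"
    and x: "linepath (blue n (fst l)) (blue n (snd l)) x \<in> chord (red n) e"
    and y: "linepath (blue n (fst l)) (blue n (snd l)) y \<in> chord (red n) f"
  shows "x < y"
proof -
  interpret V: inscribed_polygon "vert (4 * n + 4)" "4 * n + 4" by (rule inscribed_vert) simp
  note bl = edgesD[OF l] and be = edgesD[OF e(1)] and bf = edgesD[OF f(1)]
  have bounds: "2 * fst e + 1 < 4 * n + 4" "2 * snd e + 1 < 4 * n + 4" "2 * fst f + 1 < 4 * n + 4"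
    "2 * snd f + 1 < 4 * n + 4" "2 * fst l < 4 * n + 4" "2 * snd l < 4 * n + 4"
      using bl be bf by auto
  \<comment> \<open>The line is directed so that the white end of \<open>l\<close> is on its left.\<close>
  define g where "g = orient (red n (snd e)) (red n (fst e))"
  have west: "cyc (2 * fst l) (2 * fst e + 1) (2 * snd l)"
    "cyc (2 * snd l) (2 * snd e + 1) (2 * fst l)"
    using e(2) not_west[OF l] by (auto simp: passes_def west_def)
  then have "cyc (2 * fst e + 1) (2 * snd e + 1) (2 * fst l)"
    "cyc (2 * snd e + 1) (2 * fst e + 1) (2 * snd l)"
    by (smt (verit) cyclic_order)+
  then have ends: "g (blue n (fst l)) > 0" "g (blue n (snd l)) < 0"
    unfolding g_def red_vert blue_vert
    using V.orient_pos_iff[OF bounds(2,1,5)] V.orient_neg_iff[OF bounds(2,1,6)] by auto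
  let ?t = "turn (2 * n + 2) (fst l)"
  have lt: "?t (fst f) < ?t (snd f)" "?t (fst e) < ?t (snd e)"
    using e(2) f(2) west_iff_turn[OF l] be bf unfolding passes_def by force+
  have "g (red n (fst f)) < 0" if "fst e \<noteq> fst f"
  proof -
    have "?t (fst e) \<noteq> ?t (fst f)" using turn_inj that bl be bf by blast
    then have "cyc (?t (snd e)) (?t (fst e)) (?t (fst f))"
      using lt assms(7,8) unfolding cyc_def by simp
    then have "cyc (snd e) (fst e) (fst f)" using cyc_turn bl be bf by blast
    then show ?thesis unfolding g_def red_vert
      using V.orient_neg_iff[OF bounds(2,1,3)] cyc_double(1) by simp
  qed
  moreover have "g (red n (snd f)) < 0" if "snd e \<noteq> snd f"
  proof -
    have "?t (snd e) \<noteq> ?t (snd f)" using turn_inj that bl be bf by blast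
    then have "cyc (?t (snd e)) (?t (fst e)) (?t (snd f))"
      using lt assms(7,8) unfolding cyc_def by simp
    then have "cyc (snd e) (fst e) (snd f)" using cyc_turn bl be bf by blast
    then show ?thesis unfolding g_def red_vert
      using V.orient_neg_iff[OF bounds(2,1,4)] cyc_double(1) by simp
  qed
  moreover have "g (red n (fst f)) = 0" if "fst e = fst f" using that by (simp add: g_def)
  moreover have "g (red n (snd f)) = 0" if "snd e = snd f" using that by (simp add: g_def)
  moreover have "fst e \<noteq> fst f \<or> snd e \<noteq> snd f" using f(3) by (auto simp: prod_eq_iff)
  ultimately have "g (red n (fst f)) \<le> 0" "g (red n (snd f)) \<le> 0"
    "g (red n (fst f)) < 0 \<or> g (red n (snd f)) < 0"
    by fastforce+
  then have gy: "g (linepath (blue n (fst l)) (blue n (snd l)) y) < 0"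
    using orient_segment_sign(2) y unfolding g_def chord_def by blast
  have gx: "g (linepath (blue n (fst l)) (blue n (snd l)) x) = 0"
    using x by (auto simp: g_def chord_def in_segment orient_affine)
  have lin: "g (linepath (blue n (fst l)) (blue n (snd l)) t)
      = (1 - t) * g (blue n (fst l)) + t * g (blue n (snd l))" for t
    by (simp add: g_def linepath_def orient_affine)
  have "(y - x) * (g (blue n (fst l)) - g (blue n (snd l))) > 0"
    using gx gy unfolding lin by (simp add: algebra_simps)
  then show ?thesis using ends by (simp add: zero_less_mult_iff)
qed

section \<open>Flips that move clockwise along a long inner edge\<close>

text \<open>
  Entering the square through \<open>p q\<close>, the chord could leave it only across another side; so it stops
  at a vertex.
\<close>

lemma end_in_square:
  assumes "cyc p x y" "cyc p y q" "cyc p s q" "cyc q t p"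
    and "\<not> interleaved s t p x" "\<not> interleaved s t x y" "\<not> interleaved s t y q"
  shows "s = x \<or> s = y"
  using assms unfolding interleaved_def by (smt (verit) cyclic_order)

text \<open>
  Six vertices in cyclic order become sorted when the smallest one is rotated to the front.
\<close>

lemma cyclic_hexagon_sorted:
  assumes "cyc a b c" "cyc a c d" "cyc a d e" "cyc a e f"
  obtains r where "sorted_list_of_set {a, b, c, d, e, f} = rotate r [a, b, c, d, e, f]"
proof -
  have sorted: "sorted_list_of_set {a, b, c, d, e, f} = rotate r [a, b, c, d, e, f]"
    if "sorted_wrt (<) (rotate r [a, b, c, d, e, f])" for r
  proof -
    have "set (rotate r [a, b, c, d, e, f]) = {a, b, c, d, e, f}" by simp
    then show ?thesis
      using that sorted_list_of_set.idem_if_sorted_distinct[of "rotate r [a, b, c, d, e, f]"]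
      by (metis strict_sorted_iff)
  qed
  consider "a < b \<and> b < c \<and> c < d \<and> d < e \<and> e < f" | "b < c \<and> c < d \<and> d < e \<and> e < f \<and> f < a"
    | "c < d \<and> d < e \<and> e < f \<and> f < a \<and> a < b" | "d < e \<and> e < f \<and> f < a \<and> a < b \<and> b < c"
    | "e < f \<and> f < a \<and> a < b \<and> b < c \<and> c < d" | "f < a \<and> a < b \<and> b < c \<and> c < d \<and> d < e"
  proof -
    have "a < b \<and> b < c \<and> c < d \<and> d < e \<and> e < f \<or> b < c \<and> c < d \<and> d < e \<and> e < f \<and> f < a
      \<or> c < d \<and> d < e \<and> e < f \<and> f < a \<and> a < b \<or> d < e \<and> e < f \<and> f < a \<and> a < b \<and> b < c
      \<or> e < f \<and> f < a \<and> a < b \<and> b < c \<and> c < d \<or> f < a \<and> a < b \<and> b < c \<and> c < d \<and> d < e"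
      using assms unfolding cyc_def by (elim disjE conjE; simp)
    then show ?thesis using that by blast
  qed
  then show ?thesis
  proof cases
    case 1 show ?thesis by (rule that[of 0], rule sorted) (use 1 in simp)
  next
    case 2 show ?thesis by (rule that[of 1], rule sorted) (use 2 in simp)
  next
    case 3 show ?thesis by (rule that[of 2], rule sorted) (use 3 in \<open>simp add: numeral_eq_Suc\<close>)
  next
    case 4 show ?thesis by (rule that[of 3], rule sorted) (use 4 in \<open>simp add: numeral_eq_Suc\<close>)
  next
    case 5 show ?thesis by (rule that[of 4], rule sorted) (use 5 in \<open>simp add: numeral_eq_Suc\<close>)
  next
    case 6 show ?thesis by (rule that[of 5], rule sorted) (use 6 in \<open>simp add: numeral_eq_Suc\<close>)
  qed
qed

text \<open>
  This makes the numbering of the sides, which starts at the smallest vertex, available for a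
  cyclic enumeration that starts anywhere.
\<close>

lemma side_cyclic:
  assumes "cyc a b c" "cyc a c d" "cyc a d e" "cyc a e f"
  obtains r where "\<And>k. side {a, b, c, d, e, f} k =
    ([a, b, c, d, e, f] ! ((r + k) mod 6), [a, b, c, d, e, f] ! (Suc (r + k) mod 6))"
proof -
  obtain r where r: "sorted_list_of_set {a, b, c, d, e, f} = rotate r [a, b, c, d, e, f]"
    using cyclic_hexagon_sorted[OF assms] .
  have "rotate r [a, b, c, d, e, f] ! (k mod 6) = [a, b, c, d, e, f] ! ((r + k) mod 6)" for k
    using nth_rotate[of "k mod 6" "[a, b, c, d, e, f]" r] by (simp add: mod_add_right_eq)
  then show ?thesis using that[of r] by (simp add: side_def r)
qed

lemma interleaved_across:
  assumes "a < d" "a < b" "c < d" "c < b"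
  shows "interleaved a d c b \<longleftrightarrow> a < c \<and> d < b \<or> c < a \<and> b < d"
  using assms unfolding interleaved_def cyc_def by auto

locale blue_quadrangulation =
  fixes n :: nat and Q :: "edge set"
  assumes n_pos: "1 \<le> n" and quadrangulation: "quadrangulation n (blue n) Q"
begin

sublocale blue: even_polygon "blue n" n by (rule even_polygon_blue[OF n_pos])
sublocale red: even_polygon "red n" n by (rule even_polygon_red[OF n_pos])

abbreviation M :: nat where "M \<equiv> 2 * n + 2"

lemma maximal: "maximal_noncrossing n Q"
  using quadrangulation blue.quadrangulation_iff by blast

lemma Q_diagonals: "Q \<subseteq> diagonals n"
  using maximal by (simp add: maximal_noncrossing_def)

lemma Q_edges: "l \<in> Q \<Longrightarrow> l \<in> edges n"
  using Q_diagonals diagonals_edges by blast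

lemma compatible_quadrangulations_iff:
  "D \<in> compatible_quadrangulations n Q \<longleftrightarrow>
     maximal_noncrossing n D \<and> (\<forall>e\<in>D. \<forall>l\<in>Q. west l (snd e) \<longrightarrow> west l (fst e))"
proof -
  have "(\<forall>e\<in>D \<union> boundary n. compatible_edge n Q e) \<longleftrightarrow> (\<forall>e\<in>D. \<forall>l\<in>Q. west l (snd e) \<longrightarrow> west l (fst e))"
    if D: "D \<subseteq> edges n"
  proof -
    have "compatible n e l" if "e \<in> D \<union> boundary n" "l \<in> Q \<union> boundary n" "\<not> (e \<in> D \<and> l \<in> Q)" for e l
      using that boundary_compatible[of e n l] D Q_edges boundary_edges by blast
    then have "(\<forall>e\<in>D \<union> boundary n. compatible_edge n Q e) \<longleftrightarrow> (\<forall>e\<in>D. \<forall>l\<in>Q. compatible n e l)"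
      unfolding compatible_edge_def by blast
    also have "\<dots> \<longleftrightarrow> (\<forall>e\<in>D. \<forall>l\<in>Q. west l (snd e) \<longrightarrow> west l (fst e))"
      by (intro ball_cong refl compatible_iff) (use D Q_edges in blast)+
    finally show ?thesis .
  qed
  moreover have "D \<subseteq> edges n" if "maximal_noncrossing n D"
    using that diagonals_edges by (auto simp: maximal_noncrossing_def)
  ultimately show ?thesis
    unfolding compatible_quadrangulations_def mem_Collect_eq red.quadrangulation_iff by blast
qed

lemma compatible_west:
  assumes "D \<in> compatible_quadrangulations n Q" "(w, b) \<in> D \<union> boundary n" "l \<in> Q" "west l b"
  shows "west l w"
proof (cases "(w, b) \<in> D")
  case True
  then show ?thesis using assms compatible_quadrangulations_iff by force
next
  case False
  then have "(w, b) \<in> boundary n" using assms(2) by blast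
  then have "compatible n (w, b) l"
    using boundary_compatible boundary_edges Q_edges[OF assms(3)] by blast
  then show ?thesis
    using compatible_iff[of "(w, b)" n l] boundary_edges Q_edges[OF assms(3)]
      \<open>(w, b) \<in> boundary n\<close> assms(4)
    by auto
qed

lemma compatibleD:
  assumes "D \<in> compatible_quadrangulations n Q"
  shows "maximal_noncrossing n D" "D \<subseteq> diagonals n" "noncrossing D"
  using assms compatible_quadrangulations_iff by (auto simp: maximal_noncrossing_def)

text \<open>
  The staircase property: of two noncrossing edges that pass \<open>l\<close>, neither is strictly larger in both
  coordinates.
\<close>

lemma interleaved_iff_turn:
  assumes "l \<in> edges n" "(a, d) \<in> edges n" "(c, b) \<in> edges n" "passes (a, d) l" "passes (c, b) l"
  shows "interleaved a d c b \<longleftrightarrow>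
    turn M (fst l) a < turn M (fst l) c \<and> turn M (fst l) d < turn M (fst l) b \<or>
    turn M (fst l) c < turn M (fst l) a \<and> turn M (fst l) b < turn M (fst l) d"
proof -
  let ?t = "turn M (fst l)"
  note e = edgesD[OF assms(1)] edgesD[OF assms(2)] edgesD[OF assms(3)]
  have "?t a < ?t d" "?t a < ?t b" "?t c < ?t d" "?t c < ?t b"
    using assms(4,5) west_iff_turn[OF assms(1)] e unfolding passes_def by fastforce+
  moreover have "interleaved a d c b \<longleftrightarrow> interleaved (?t a) (?t d) (?t c) (?t b)"
    unfolding interleaved_def using e cyc_turn by simp
  ultimately show ?thesis using interleaved_across by simp
qed

text \<open>
  The combinatorial form of an oriented flip: \<open>i\<close> is the diagonal (id) and \<open>j\<close> is (op), the two
  opposite sides of the hexagon crossed by the long edge \<open>l\<close> join the white end of each to the black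
  end of the other, and both ends of the diagonal move clockwise.
\<close>

definition clockwise_flip :: "edge set \<Rightarrow> edge \<Rightarrow> edge \<Rightarrow> edge set \<Rightarrow> edge \<Rightarrow> bool" where
  "clockwise_flip Q' i j Q'' l \<longleftrightarrow> flip n Q Q' i j Q'' \<and> l \<in> Q \<and>
     (fst i, snd j) \<in> Q' \<union> boundary n \<and> (fst j, snd i) \<in> Q' \<union> boundary n \<and>
     passes (fst i, snd j) l \<and> passes (fst j, snd i) l \<and>
     turn M (fst l) (fst i) < turn M (fst l) (fst j) \<and>
     turn M (fst l) (snd i) < turn M (fst l) (snd j)"

text \<open>
  Opposite vertices of a square have the same colour, so two vertices of different colours are
  neighbours.
\<close>

lemma square_through_edge:
  assumes "D \<subseteq> diagonals n" "S \<in> squares n (red n) D" "a \<in> S" "b \<in> S" "even a" "odd b"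
  shows "\<exists>p q x y. ((p, q) = (a, b) \<or> (p, q) = (b, a)) \<and> S = {p, x, y, q} \<and>
    cyc p x y \<and> cyc p y q \<and> joined n D p x \<and> joined n D x y \<and> joined n D y q"
proof -
  obtain s t u v where S: "S = {s, t, u, v}" "s < t" "t < u" "u < v"
    and j: "joined n D s t" "joined n D t u" "joined n D u v" "joined n D v s"
    using red.squaresE[OF assms(2,1)] by metis
  note par = j[THEN joined_bounds(3)[OF _ assms(1)]]
  have "(a, b) \<in> {(s, t), (t, u), (u, v), (v, s)} \<or> (b, a) \<in> {(s, t), (t, u), (u, v), (v, s)}"
    using assms(3-6) par unfolding S(1) by auto
  then obtain p q where pq: "(p, q) = (a, b) \<or> (p, q) = (b, a)"
    "(q, p) \<in> {(s, t), (t, u), (u, v), (v, s)}" by blast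
  have cyc: "cyc s t u" "cyc s u v" "cyc t u v" "cyc t v s" "cyc u v s" "cyc u s t" "cyc v s t"
    "cyc v t u"
    using S(2-4) by (simp_all add: cyc_def)
  consider "q = s \<and> p = t" | "q = t \<and> p = u" | "q = u \<and> p = v" | "q = v \<and> p = s"
    using pq(2) by blast
  then show ?thesis
  proof cases
    case 1
    then show ?thesis using pq(1) S(1) j cyc
      by (intro exI[of _ p] exI[of _ q] exI[of _ u] exI[of _ v]) (simp add: insert_commute)
  next
    case 2
    then show ?thesis using pq(1) S(1) j cyc
      by (intro exI[of _ p] exI[of _ q] exI[of _ v] exI[of _ s]) (simp add: insert_commute)
  next
    case 3
    then show ?thesis using pq(1) S(1) j cyc
      by (intro exI[of _ p] exI[of _ q] exI[of _ s] exI[of _ t]) (simp add: insert_commute)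
  next
    case 4
    then show ?thesis using pq(1) S(1) j cyc
      by (intro exI[of _ p] exI[of _ q] exI[of _ t] exI[of _ u]) (simp add: insert_commute)
  qed
qed

text \<open>
  Two different squares on the same edge lie on different sides of it.
\<close>

lemma hexagon_of_edge:
  assumes "D \<subseteq> diagonals n" "noncrossing D" "(a, b) \<in> D" "is_hexagon n D (a, b) H"
  obtains x y x' y' where "H = {a, x, y, b, x', y'}"
    "cyc a x y" "cyc a y b" "joined n D a x" "joined n D x y" "joined n D y b"
    "cyc b x' y'" "cyc b y' a" "joined n D b x'" "joined n D x' y'" "joined n D y' a"
proof -
  have ab: "even a" "odd b" using edgesD[of "(a, b)" n] assms(1,3) diagonals_edges by auto
  obtain S T where ST: "S \<in> squares n (red n) D" "T \<in> squares n (red n) D" "S \<noteq> T"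
    "a \<in> S" "b \<in> S" "a \<in> T" "b \<in> T" "H = S \<union> T"
    using assms(4) by (auto simp: is_hexagon_def)
  obtain p q x y where S: "(p, q) = (a, b) \<or> (p, q) = (b, a)" "S = {p, x, y, q}"
    "cyc p x y" "cyc p y q" "joined n D p x" "joined n D x y" "joined n D y q"
    using square_through_edge[OF assms(1) ST(1,4,5) ab] by blast
  obtain p' q' x' y' where T: "(p', q') = (a, b) \<or> (p', q') = (b, a)" "T = {p', x', y', q'}"
    "cyc p' x' y'" "cyc p' y' q'" "joined n D p' x'" "joined n D x' y'" "joined n D y' q'"
    using square_through_edge[OF assms(1) ST(2,6,7) ab] by blast
  have "p \<noteq> p'"
  proof
    assume "p = p'"
    moreover then have "q = q'" using S(1) T(1) ab by auto
    ultimately show False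
      using square_on_side_unique[OF assms(1,2) S(3-7), of x' y'] T S(2) ST(3) by blast
  qed
  then consider "p = a \<and> q = b \<and> p' = b \<and> q' = a" | "p = b \<and> q = a \<and> p' = a \<and> q' = b"
    using S(1) T(1) by blast
  then show ?thesis
  proof cases
    case 1
    then show ?thesis using that[of x y x' y'] S T ST(8) by (simp add: insert_commute)
  next
    case 2
    then show ?thesis using that[of x' y' x y] S T ST(8) by (simp add: insert_commute Un_commute)
  qed
qed

text \<open>
  The new diagonal \<open>j\<close> has to cross an edge of the maximal set \<open>Q'\<close>, and crosses none of those that
  stay.
\<close>

lemma flipD:
  assumes "flip n Q Q' i j Q''"
  shows "interleaved (fst i) (snd i) (fst j) (snd j)"
    and "joined n Q' x y \<Longrightarrow> {x, y} \<noteq> {fst i, snd i} \<Longrightarrow> \<not> interleaved (fst j) (snd j) x y"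
    and "i \<in> edges n" "j \<in> edges n" "i \<in> diagonals n"
proof -
  have f: "Q' \<in> compatible_quadrangulations n Q" "i \<in> Q'" "j \<notin> Q'"
    "Q'' = insert j (Q' - {i})" "Q'' \<in> compatible_quadrangulations n Q"
    using assms by (auto simp: flip_def)
  note c' = compatibleD[OF f(1)] and c'' = compatibleD[OF f(5)]
  have "j \<in> diagonals n - Q'" using f(3,4) c''(2) by auto
  then obtain g where g: "g \<in> Q'" "interleaved (fst j) (snd j) (fst g) (snd g)"
    using c'(1) unfolding maximal_noncrossing_def by blast
  have "g = i"
  proof (rule ccontr)
    assume "g \<noteq> i"
    then have "g \<in> Q''" "j \<in> Q''" using g(1) f(4) by auto
    then show False using g(2) c''(3) by (auto simp: noncrossing_def)
  qed
  then show "interleaved (fst i) (snd i) (fst j) (snd j)" using g(2) interleaved_sym by blast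
  show "i \<in> diagonals n" using f(2) c'(2) by blast
  then show "i \<in> edges n" "j \<in> edges n" using \<open>j \<in> diagonals n - Q'\<close> diagonals_edges by blast+
  show "\<not> interleaved (fst j) (snd j) x y" if "joined n Q' x y" "{x, y} \<noteq> {fst i, snd i}"
  proof -
    have "joined n Q'' x y" using that f(4) by (auto simp: joined_def)
    moreover have "joined n Q'' (fst j) (snd j)" using f(4) by (auto simp: joined_def)
    ultimately show ?thesis using joined_not_interleaved[OF c''(2,3)] by blast
  qed
qed

lemma flip_end_in_square:
  assumes "flip n Q Q' i j Q''" "{p, q} = {fst i, snd i}" "{s, t} = {fst j, snd j}"
    and "cyc p x y" "cyc p y q" "joined n Q' p x" "joined n Q' x y" "joined n Q' y q" "cyc p s q"
  shows "s = x \<or> s = y"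
proof -
  have "interleaved p q s t"
    using flipD(1)[OF assms(1)] assms(2,3) interleaved_flip unfolding doubleton_eq_iff by metis
  then have "cyc q t p" using assms(9) cyc_asym[of p s q] cyc_rotate[of q s p] cyc_rotate[of s p q]
    unfolding interleaved_def by blast
  moreover have "{p, x} \<noteq> {p, q}" "{x, y} \<noteq> {p, q}" "{y, q} \<noteq> {p, q}"
    using assms(4,5) by (auto simp: doubleton_eq_iff cyc_def)
  then have "\<not> interleaved (fst j) (snd j) p x" "\<not> interleaved (fst j) (snd j) x y"
    "\<not> interleaved (fst j) (snd j) y q"
    using flipD(2)[OF assms(1)] assms(2,6,7,8) by auto
  then have "\<not> interleaved s t p x" "\<not> interleaved s t x y" "\<not> interleaved s t y q"
    using assms(3) interleaved_flip(1) unfolding doubleton_eq_iff by metis+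
  ultimately show ?thesis using end_in_square[OF assms(4,5,9)] by blast
qed

text \<open>
  If \<open>l\<close> meets \<open>(a, d)\<close> first, then \<open>(a, d)\<close> has the smaller white coordinate, since \<open>passing_order\<close> would
  give the opposite order of the crossing points otherwise.
\<close>

lemma enters_leaves_order:
  assumes D: "D \<in> compatible_quadrangulations n Q" and l: "l \<in> Q"
    and e: "(a, d) \<in> D \<union> boundary n" and f: "(c, b) \<in> D \<union> boundary n" and ne: "a \<noteq> c" "b \<noteq> d"
    and x: "0 < x" "x < 1" "linepath (blue n (fst l)) (blue n (snd l)) x \<in> chord (red n) (a, d)"
    and y: "0 < y" "y < 1" "linepath (blue n (fst l)) (blue n (snd l)) y \<in> chord (red n) (c, b)"
    and xy: "x < y"
  shows "passes (a, d) l" "passes (c, b) l"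
    "turn M (fst l) a < turn M (fst l) c" "turn M (fst l) b < turn M (fst l) d"
proof -
  note lE = Q_edges[OF l]
  have eE: "(a, d) \<in> edges n" "(c, b) \<in> edges n"
    using e f compatibleD(2)[OF D] diagonals_edges boundary_edges by blast+
  have "blue n (fst l) \<noteq> blue n (snd l)" using edgesD[OF lE] blue.distinct by metis
  then have on: "linepath (blue n (fst l)) (blue n (snd l)) t \<in> chord (blue n) l" if "0 < t" "t < 1"
    for t
    using that by (auto simp: chord_def in_segment linepath_def)
  have pass: "passes (w, v) l" if "(w, v) \<in> D \<union> boundary n" "(w, v) \<in> edges n" "0 < t" "t < 1"
    "linepath (blue n (fst l)) (blue n (snd l)) t \<in> chord (red n) (w, v)" for w v t
  proof -
    have "crosses (red n) (w, v) (blue n) l" using that on unfolding crosses_def by blast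
    then show ?thesis
      using crosses_iff_west[OF that(2) lE] compatible_west[OF D that(1) l]
      by (auto simp: passes_def)
  qed
  show p: "passes (a, d) l" "passes (c, b) l" using pass e f eE x y by blast+
  have "\<not> interleaved a d c b"
    using joined_not_interleaved[OF compatibleD(2,3)[OF D]] e f by (auto simp: joined_def)
  then have no: "\<not> (turn M (fst l) a < turn M (fst l) c \<and> turn M (fst l) d < turn M (fst l) b)"
    "\<not> (turn M (fst l) c < turn M (fst l) a \<and> turn M (fst l) b < turn M (fst l) d)"
    using interleaved_iff_turn[OF lE eE p] by blast+
  have neq: "turn M (fst l) a \<noteq> turn M (fst l) c" "turn M (fst l) d \<noteq> turn M (fst l) b"
    using turn_inj[of "fst l" M] ne edgesD[OF lE] edgesD[OF eE(1)] edgesD[OF eE(2)] by auto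
  have "\<not> turn M (fst l) c < turn M (fst l) a"
  proof
    assume "turn M (fst l) c < turn M (fst l) a"
    then have "y < x"
      using passing_order[OF lE eE(2) p(2) eE(1) p(1) _ _ _ y(3) x(3)] no neq ne by auto
    then show False using xy by simp
  qed
  then show "turn M (fst l) a < turn M (fst l) c" "turn M (fst l) b < turn M (fst l) d"
    using no neq by linarith+
qed

text \<open>
  Enumerate the hexagon from the white end of \<open>i\<close>. This end lies on the side \<open>k\<close>, which leaves two
  positions for the side. In each of them the colours and the sides not crossed by \<open>j\<close> determine the
  ends of \<open>j\<close>.
\<close>

lemma oriented_flip_clockwise:
  assumes "(Q', Q'') \<in> oriented_flips n Q"
  shows "\<exists>i j l. clockwise_flip Q' i j Q'' l"
proof -
  obtain i j H l k where f: "flip n Q Q' i j Q''" and H: "is_hexagon n Q' i H" and l: "l \<in> Q"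
    "k < 6"
    and el: "enters_leaves n l (side H k) (side H (k + 3))"
    and i: "fst i \<in> {fst (side H k), snd (side H k)}"
    and j: "fst j \<in> {fst (side H (k + 3)), snd (side H (k + 3))}"
    using assms unfolding oriented_flips_def by auto
  obtain a b c d where ij: "i = (a, b)" "j = (c, d)" by (cases i, cases j)
  have Q': "Q' \<in> compatible_quadrangulations n Q" and iQ: "(a, b) \<in> Q'"
    using f ij by (auto simp: flip_def)
  have par: "even a" "odd b" "even c" "odd d" using flipD(3,4)[OF f] edgesD ij by force+
  note D = compatibleD[OF Q']
  obtain x y x' y' where hex: "H = {a, x, y, b, x', y'}"
    "cyc a x y" "cyc a y b" "joined n Q' a x" "joined n Q' x y" "joined n Q' y b"
    "cyc b x' y'" "cyc b y' a" "joined n Q' b x'" "joined n Q' x' y'" "joined n Q' y' a"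
    using hexagon_of_edge[OF D(2,3) iQ] H ij by metis
  have cycs: "cyc a x y" "cyc a y b" "cyc a b x'" "cyc a x' y'"
    using hex(2,3,7,8) by (smt (verit) cyclic_order)+
  have xy: "odd x" "even y" "even x'" "odd y'"
    using hex(4-6,9-11)[THEN joined_bounds(3)[OF _ D(2)]] par by blast+
  obtain r where r: "\<And>k. side H k = ([a, x, y, b, x', y'] ! ((r + k) mod 6), [a, x, y, b, x', y'] ! (Suc (r + k) mod 6))"
    using side_cyclic[OF cycs] unfolding hex(1) by blast
  define m where "m = (r + k) mod 6"
  have "(r + (k + 3)) mod 6 = (m + 3) mod 6" "Suc (r + (k + 3)) mod 6 = (m + 4) mod 6"
    "Suc (r + k) mod 6 = Suc m mod 6" unfolding m_def by presburger+
  then have s: "side H k = ([a, x, y, b, x', y'] ! m, [a, x, y, b, x', y'] ! (Suc m mod 6))"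
    "side H (k + 3) = ([a, x, y, b, x', y'] ! ((m + 3) mod 6), [a, x, y, b, x', y'] ! ((m + 4) mod 6))"
    using r m_def by metis+
  have dist: "a \<notin> {x, y, b, x', y'}" using cycs by (auto simp: cyc_def)
  have "m < 6" by (simp add: m_def)
  then consider "m = 0" | "m = 1" | "m = 2" | "m = 3" | "m = 4" | "m = 5" by linarith
  then have m: "m = 0 \<or> m = 5"
    using i dist unfolding ij s by cases auto
  have dc: "d = x \<and> c = x' \<and> chord (red n) (side H k) = chord (red n) (a, d) \<and>
        chord (red n) (side H (k + 3)) = chord (red n) (c, b) \<or>
      d = y' \<and> c = y \<and> chord (red n) (side H k) = chord (red n) (a, d) \<and>
        chord (red n) (side H (k + 3)) = chord (red n) (c, b)"
    using m
  proof
    assume m0: "m = 0"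
    then have "c = x'" using j s(2) par xy unfolding ij by auto
    moreover have "cyc a d b"
      using flipD(1)[OF f] cycs \<open>c = x'\<close> cyc_asym[of a b c] cyc_rotate[of c a b]
        cyc_rotate[of b c a]
      unfolding ij interleaved_def by auto
    then have "d = x \<or> d = y"
      using flip_end_in_square[OF f, of a b d c] hex unfolding ij by auto
    then have "d = x" using par xy by auto
    ultimately show ?thesis using s m0 chord_commute by auto
  next
    assume m5: "m = 5"
    then have "c = y" using j s(2) par xy unfolding ij by auto
    moreover have "cyc b d a"
      using flipD(1)[OF f] hex(3) \<open>c = y\<close> cyc_asym[of a c b] cyc_rotate[of b c a]
        cyc_rotate[of c a b]
      unfolding ij interleaved_def by auto
    then have "d = x' \<or> d = y'"
      using flip_end_in_square[OF f, of b a d c] hex unfolding ij by auto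
    then have "d = y'" using par xy by auto
    ultimately show ?thesis using s m5 chord_commute by auto
  qed
  have jo: "joined n Q' a d" "joined n Q' c b" using dc hex joined_sym by blast+
  then have e: "(a, d) \<in> Q' \<union> boundary n" "(c, b) \<in> Q' \<union> boundary n"
    using joined_white D(2) par by blast+
  have ne: "a \<noteq> c" "b \<noteq> d" using dc cycs by (auto simp: cyc_def)
  have ch: "chord (red n) (side H k) = chord (red n) (a, d)"
    "chord (red n) (side H (k + 3)) = chord (red n) (c, b)" using dc by blast+
  obtain u v where "0 < u" "u < v" "v < 1"
    "linepath (blue n (fst l)) (blue n (snd l)) u \<in> chord (red n) (a, d)"
    "linepath (blue n (fst l)) (blue n (snd l)) v \<in> chord (red n) (c, b)"
    using el unfolding enters_leaves_def ch by blast
  then have "passes (a, d) l" "passes (c, b) l"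
    "turn M (fst l) a < turn M (fst l) c" "turn M (fst l) b < turn M (fst l) d"
    using enters_leaves_order[OF Q' l(1) e ne, of u v] by auto
  then have "clockwise_flip Q' i j Q'' l"
    using f l(1) e by (simp add: clockwise_flip_def ij)
  then show ?thesis by blast
qed

lemma clockwise_flip_order:
  assumes "clockwise_flip Q' (a, b) (c, d) Q'' l"
  shows "cyc a c b" "cyc a b d" "west l a" "west l c" "\<not> west l b" "\<not> west l d"
proof -
  have f: "flip n Q Q' (a, b) (c, d) Q''" and l: "l \<in> Q"
    and p: "passes (a, d) l" "passes (c, b) l"
    and t: "turn M (fst l) a < turn M (fst l) c" "turn M (fst l) b < turn M (fst l) d"
    using assms by (auto simp: clockwise_flip_def)
  note e = edgesD[OF flipD(3)[OF f], simplified] edgesD[OF flipD(4)[OF f], simplified]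
    edgesD[OF Q_edges[OF l]]
  show w: "west l a" "west l c" "\<not> west l b" "\<not> west l d" using p by (auto simp: passes_def)
  then have "turn M (fst l) c < turn M (fst l) b"
    using west_iff_turn[OF Q_edges[OF l]] e by force
  then have "cyc (turn M (fst l) a) (turn M (fst l) c) (turn M (fst l) b)"
    "cyc (turn M (fst l) a) (turn M (fst l) b) (turn M (fst l) d)"
    using t by (auto simp: cyc_def)
  then show "cyc a c b" "cyc a b d" using cyc_turn e by auto
qed

text \<open>
  The squares of \<open>Q'\<close> on the two sides of \<open>i\<close> form the hexagon. An end of \<open>j\<close> is one of the two vertices
  of a square opposite to \<open>i\<close>, and its colour tells which.
\<close>

lemma clockwise_flip_oriented:
  assumes "clockwise_flip Q' i j Q'' l"
  shows "(Q', Q'') \<in> oriented_flips n Q"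
proof -
  obtain a b c d where ij: "i = (a, b)" "j = (c, d)" by (cases i, cases j)
  have f: "flip n Q Q' i j Q''" and l: "l \<in> Q"
    and p: "passes (a, d) l" "passes (c, b) l"
    and E: "(a, d) \<in> Q' \<union> boundary n" "(c, b) \<in> Q' \<union> boundary n"
    and t: "turn M (fst l) a < turn M (fst l) c" "turn M (fst l) b < turn M (fst l) d"
    using assms by (auto simp: clockwise_flip_def ij)
  note cyc = clockwise_flip_order(1,2)[OF assms[unfolded ij]]
  have Q': "Q' \<in> compatible_quadrangulations n Q" and iQ: "(a, b) \<in> Q'"
    using f ij by (auto simp: flip_def)
  note D = compatibleD[OF Q']
  have par: "even a" "odd b" "even c" "odd d" using flipD(3,4)[OF f] edgesD ij by force+
  have jab: "joined n Q' a b" "joined n Q' b a" using iQ by (auto simp: joined_def)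
  have "(a, b) \<notin> boundary n" "(a, b) \<in> edges n" using iQ D(2) by (auto simp: diagonals_def)
  then have nb: "b \<noteq> next_vertex n a" "a \<noteq> next_vertex n b" by (auto simp: boundary_iff)
  obtain x y where S: "cyc a x y" "cyc a y b" "joined n Q' a x" "joined n Q' x y" "joined n Q' y b"
    using square_on_side[OF D(1) jab(1) nb(1)] by metis
  obtain x' y' where T: "cyc b x' y'" "cyc b y' a" "joined n Q' b x'" "joined n Q' x' y'"
    "joined n Q' y' a"
    using square_on_side[OF D(1) jab(2) nb(2)] by metis
  have xy: "odd x" "even x'"
    using S(3) T(3) joined_bounds(3)[OF _ D(2)] par by blast+
  have "c = x \<or> c = y" using flip_end_in_square[OF f, of a b c d] S cyc(1) unfolding ij by auto
  then have c: "y = c" using xy par by auto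
  have "cyc b d a" using cyc(2) by (rule cyc_rotate)
  then have "d = x' \<or> d = y'" using flip_end_in_square[OF f, of b a d c] T unfolding ij by auto
  then have d: "y' = d" using xy par by auto
  let ?H = "{a, x, c, b, x', d}"
  have cycs: "cyc a x c" "cyc a c b" "cyc a b x'" "cyc a x' d"
    using S(1,2) T(1,2) unfolding c d by (smt (verit) cyclic_order)+
  have "{a, x, c, b} \<in> squares n (red n) Q'" "{b, x', d, a} \<in> squares n (red n) Q'"
    using red.square_in_squares[OF D(2,3) S jab(2)] red.square_in_squares[OF D(2,3) T jab(1)]
    by (simp_all only: c d)
  moreover have "{a, x, c, b} \<noteq> {b, x', d, a}"
  proof -
    have "x \<noteq> b" "x \<noteq> x'" "x \<noteq> d" "x \<noteq> a"
      using cycs cyc_irrefl by (smt (verit) cyclic_order)+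
    then have "x \<notin> {b, x', d, a}" by blast
    then show ?thesis by blast
  qed
  ultimately have hex: "is_hexagon n Q' i ?H"
    unfolding is_hexagon_def ij by (intro bexI[of _ "{a, x, c, b}"] bexI[of _ "{b, x', d, a}"]) auto
  obtain r where r: "\<And>k. side ?H k = ([a, x, c, b, x', d] ! ((r + k) mod 6), [a, x, c, b, x', d] ! (Suc (r + k) mod 6))"
    using side_cyclic[OF cycs] by blast
  \<comment> \<open>Modulo 6 this solves \<open>r + k = 5\<close>: side 5 of the enumeration is \<open>(d, a)\<close>.\<close>
  define k where "k = (5 * r + 5) mod 6"
  have "(r + k) mod 6 = (6 * r + 5) mod 6" unfolding k_def mod_add_right_eq by simp
  then have r5: "(r + k) mod 6 = 5" unfolding mod_mult_self4 by simp
  have "Suc m mod 6 = 0 \<and> (m + 3) mod 6 = 2 \<and> Suc (m + 3) mod 6 = 3" if "m mod 6 = 5" for m :: nat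
    using that by presburger
  from this[OF r5] have k: "k < 6" "(r + k) mod 6 = 5" "Suc (r + k) mod 6 = 0"
    "(r + (k + 3)) mod 6 = 2" "Suc (r + (k + 3)) mod 6 = 3"
    using r5 by (simp_all add: k_def add.assoc)
  have s: "side ?H k = (d, a)" "side ?H (k + 3) = (c, b)"
    unfolding r k(2-5) by simp_all
  have lE: "l \<in> edges n" and eE: "(a, d) \<in> edges n" "(c, b) \<in> edges n"
    using Q_edges[OF l] E D(2) diagonals_edges boundary_edges by blast+
  obtain u where u: "0 < u" "u < 1"
    "linepath (blue n (fst l)) (blue n (snd l)) u \<in> chord (red n) (a, d)"
    using passing_point[OF eE(1) lE p(1)] by blast
  obtain v where v: "0 < v" "v < 1"
    "linepath (blue n (fst l)) (blue n (snd l)) v \<in> chord (red n) (c, b)"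
    using passing_point[OF eE(2) lE p(2)] by blast
  have "a \<noteq> c" using cyc by auto
  then have "u < v" using passing_order[OF lE eE(1) p(1) eE(2) p(2) _ _ _ u(3) v(3)] t by simp
  then have "enters_leaves n l (side ?H k) (side ?H (k + 3))"
    unfolding enters_leaves_def s using u v chord_commute by metis
  then show ?thesis
    unfolding oriented_flips_def using f hex l k(1) s ij
    by (intro CollectI case_prodI exI[of _ i] exI[of _ j] exI[of _ ?H] conjI bexI[of _ l] exI[of _ k]) auto
qed

theorem oriented_flips_iff:
  "(Q', Q'') \<in> oriented_flips n Q \<longleftrightarrow> (\<exists>i j l. clockwise_flip Q' i j Q'' l)"
  using oriented_flip_clockwise clockwise_flip_oriented by blast

end

section \<open>The order generated by the flips\<close>

context blue_quadrangulation
begin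

text \<open>
  The points strictly below the staircase of \<open>D\<close> along \<open>l\<close>.
\<close>

definition under :: "edge \<Rightarrow> edge set \<Rightarrow> edge set" where
  "under l D = {(w, b). \<exists>c d. (c, d) \<in> D \<union> boundary n \<and> passes (c, d) l \<and>
     turn M (fst l) w < turn M (fst l) c \<and> turn M (fst l) b < turn M (fst l) d}"

lemma flip_vertices:
  assumes "flip n Q Q' (a, b) (c, d) Q''"
  shows "a < M" "b < M" "c < M" "d < M" "even a" "odd b" "even c" "odd d"
  using edgesD[OF flipD(3)[OF assms]] edgesD[OF flipD(4)[OF assms]] by auto

lemma turn_west_east:
  assumes "l \<in> edges n" "x < M" "y < M" "west l x" "\<not> west l y"
  shows "turn M (fst l) x < turn M (fst l) y"
  using west_iff_turn[OF assms(1,2)] west_iff_turn[OF assms(1,3)] assms(4,5) by linarith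

lemma cyc_turn_edge:
  assumes "l \<in> edges n" "x < M" "y < M" "z < M" "cyc x y z"
  shows "cyc (turn M (fst l) x) (turn M (fst l) y) (turn M (fst l) z)"
  using cyc_turn edgesD[OF assms(1)] assms by blast

text \<open>
  Only the points below the removed edge \<open>i = (a, b)\<close> are in danger, and only if \<open>i\<close> passes \<open>l2\<close>. If \<open>d\<close>
  is not west of \<open>l2\<close>, the side \<open>(a, d)\<close> passes \<open>l2\<close> and dominates \<open>i\<close>. Otherwise \<open>c\<close> is west of \<open>l2\<close> by
  compatibility of \<open>j = (c, d)\<close>, and the side \<open>(c, b)\<close> does so.
\<close>

lemma under_mono:
  assumes cf: "clockwise_flip Q' i j Q'' l" and l2: "l2 \<in> Q"
  shows "under l2 Q' \<subseteq> under l2 Q''"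
proof
  fix e assume "e \<in> under l2 Q'"
  then obtain w v c0 d0 where e: "e = (w, v)" and cd: "(c0, d0) \<in> Q' \<union> boundary n"
    "passes (c0, d0) l2"
    "turn M (fst l2) w < turn M (fst l2) c0" "turn M (fst l2) v < turn M (fst l2) d0"
    by (auto simp: under_def)
  obtain a b c d where ij: "i = (a, b)" "j = (c, d)" by (cases i, cases j)
  have f: "flip n Q Q' (a, b) (c, d) Q''" and E: "(a, d) \<in> Q' \<union> boundary n"
    "(c, b) \<in> Q' \<union> boundary n"
    using cf by (auto simp: clockwise_flip_def ij)
  have Q'': "Q'' = insert (c, d) (Q' - {(a, b)})" "Q'' \<in> compatible_quadrangulations n Q"
    using f by (auto simp: flip_def)
  note ord = clockwise_flip_order(1,2)[OF cf[unfolded ij]]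
  note vs = flip_vertices[OF f] and lE = Q_edges[OF l2]
  show "e \<in> under l2 Q''"
  proof (cases "(c0, d0) = (a, b)")
    case False
    then have "(c0, d0) \<in> Q'' \<union> boundary n" using cd(1) Q''(1) by blast
    then show ?thesis using cd(2-) unfolding e under_def by blast
  next
    case True
    then have ab: "west l2 a" "\<not> west l2 b" using cd(2) by (auto simp: passes_def)
    then have tab: "turn M (fst l2) a < turn M (fst l2) b" using turn_west_east lE vs by blast
    show ?thesis
    proof (cases "west l2 d")
      case False
      have "(a, d) \<in> Q'' \<union> boundary n" using E(1) Q''(1) ord(2) by auto
      moreover have "passes (a, d) l2" using ab False by (simp add: passes_def)
      moreover have "turn M (fst l2) a < turn M (fst l2) d"
        using turn_west_east lE vs ab False by blast
      then have "turn M (fst l2) b < turn M (fst l2) d"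
        using cyc_turn_edge[OF lE vs(1,2,4) ord(2)] tab unfolding cyc_def by linarith
      ultimately show ?thesis using cd(3,4) True unfolding e under_def by fastforce
    next
      case True': True
      have "west l2 c"
        using compatible_west[OF Q''(2), of c d l2] Q''(1) l2 True' by blast
      have "(c, b) \<in> Q'' \<union> boundary n" using E(2) Q''(1) ord(1) by auto
      moreover have "passes (c, b) l2" using ab \<open>west l2 c\<close> by (simp add: passes_def)
      moreover have "turn M (fst l2) c < turn M (fst l2) b"
        using turn_west_east lE vs ab \<open>west l2 c\<close> by blast
      then have "turn M (fst l2) a < turn M (fst l2) c"
        using cyc_turn_edge[OF lE vs(1,3,2) ord(1)] tab unfolding cyc_def by linarith
      ultimately show ?thesis using cd(3,4) True unfolding e under_def by fastforce
    qed
  qed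
qed

lemma removed_under:
  assumes "clockwise_flip Q' i j Q'' l"
  shows "i \<in> under l Q''" "passes i l"
proof -
  obtain a b c d where ij: "i = (a, b)" "j = (c, d)" by (cases i, cases j)
  have "(c, d) \<in> Q''" using assms by (auto simp: clockwise_flip_def flip_def ij)
  moreover have "passes (c, d) l" "passes i l" "turn M (fst l) a < turn M (fst l) c"
    "turn M (fst l) b < turn M (fst l) d"
    using assms by (auto simp: clockwise_flip_def passes_def ij)
  ultimately show "i \<in> under l Q''" "passes i l" by (auto simp: under_def ij)
qed

text \<open>
  A member of \<open>D\<close> below the staircase would cross the edge that lies above it.
\<close>

lemma under_disjoint:
  assumes "D \<in> compatible_quadrangulations n Q" "l \<in> Q" "e \<in> under l D" "passes e l"
  shows "e \<notin> D"
proof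
  assume eD: "e \<in> D"
  obtain w b where e: "e = (w, b)" by (cases e)
  obtain c d where cd: "(c, d) \<in> D \<union> boundary n" "passes (c, d) l"
    "turn M (fst l) w < turn M (fst l) c" "turn M (fst l) b < turn M (fst l) d"
    using assms(3) by (auto simp: under_def e)
  have "(w, b) \<in> edges n" "(c, d) \<in> edges n"
    using eD cd(1) e compatibleD(2)[OF assms(1)] diagonals_edges boundary_edges by blast+
  then have "interleaved w b c d"
    using interleaved_iff_turn[OF Q_edges[OF assms(2)]] cd assms(4) e by blast
  moreover have "\<not> interleaved w b c d"
    using joined_not_interleaved[OF compatibleD(2,3)[OF assms(1)]] eD cd(1) e
    by (auto simp: joined_def)
  ultimately show False by simp
qed

lemma oriented_flips_vertices:
  assumes "(x, y) \<in> oriented_flips n Q"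
  shows "x \<in> compatible_quadrangulations n Q" "y \<in> compatible_quadrangulations n Q"
  using assms by (auto simp: oriented_flips_def flip_def)

text \<open>
  The flip puts \<open>i\<close> below the staircase of a long edge, where it stays.
\<close>

lemma removed_edge_never_returns:
  assumes "clockwise_flip x i j y l" "(y, z) \<in> (oriented_flips n Q)\<^sup>*"
  shows "i \<notin> z"
proof -
  have l: "l \<in> Q" and y: "y \<in> compatible_quadrangulations n Q"
    using assms(1) by (auto simp: clockwise_flip_def flip_def)
  have "i \<in> under l z \<and> z \<in> compatible_quadrangulations n Q"
    using assms(2)
  proof (induction rule: rtrancl_induct)
    case base
    then show ?case using removed_under(1)[OF assms(1)] y by blast
  next
    case (step u v)
    obtain i' j' l' where "clockwise_flip u i' j' v l'" using step(2) oriented_flips_iff by blast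
    then show ?case using under_mono l step oriented_flips_vertices by blast
  qed
  then show ?thesis using under_disjoint l removed_under(2)[OF assms(1)] by blast
qed

lemma acyclic_oriented_flips: "(x, x) \<notin> (oriented_flips n Q)\<^sup>+"
proof
  assume "(x, x) \<in> (oriented_flips n Q)\<^sup>+"
  then obtain y where y: "(x, y) \<in> oriented_flips n Q" "(y, x) \<in> (oriented_flips n Q)\<^sup>*"
    using tranclD by metis
  then obtain i j l where f: "clockwise_flip x i j y l" using oriented_flips_iff by blast
  then have "i \<in> x" by (auto simp: clockwise_flip_def flip_def)
  then show False using removed_edge_never_returns[OF f y(2)] by blast
qed

text \<open>
  If the new diagonals differed in their white ends, one of them would cross the side of the
  hexagon that belongs to the other one; the same holds for the black ends.
\<close>

lemma clockwise_flip_unique: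
  assumes f: "clockwise_flip Q' i j Q'' l" and f': "clockwise_flip Q' i j' P l'"
  shows "j' = j"
proof -
  obtain a b c d c' d' where ij: "i = (a, b)" "j = (c, d)" "j' = (c', d')"
    by (cases i, cases j, cases j')
  note o = clockwise_flip_order(1,2)[OF f[unfolded ij]]
    clockwise_flip_order(1,2)[OF f'[unfolded ij]]
  have fl: "flip n Q Q' i j Q''" "flip n Q Q' i j' P" using f f' by (auto simp: clockwise_flip_def)
  have "joined n Q' a d" "joined n Q' c b" "joined n Q' a d'" "joined n Q' c' b"
    using f f' by (auto simp: clockwise_flip_def joined_def ij)
  moreover have "{a, d} \<noteq> {a, b}" "{c, b} \<noteq> {a, b}" "{a, d'} \<noteq> {a, b}" "{c', b} \<noteq> {a, b}"
    using o by (auto simp: doubleton_eq_iff)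
  ultimately have ni: "\<not> interleaved c' d' a d" "\<not> interleaved c' d' c b"
    "\<not> interleaved c d a d'" "\<not> interleaved c d c' b"
    using flipD(2)[OF fl(1)] flipD(2)[OF fl(2)] unfolding ij by auto
  have "c' = c"
    using o ni(2,4)
      unfolding interleaved_def by (smt (verit) cyc_rotate cyc_trans cyc_total cyc_asym)
  moreover have "d' = d"
    using o ni(1,3)
      unfolding interleaved_def by (smt (verit) cyc_rotate cyc_trans cyc_total cyc_asym)
  ultimately show ?thesis by (simp add: ij)
qed

text \<open>
  The first flip on a path from \<open>x\<close> to \<open>y\<close> removes an edge that does not return, hence the only edge
  of \<open>x\<close> that is missing from \<open>y\<close>. So the path has reached \<open>y\<close> after one step.
\<close>

lemma oriented_flips_reduced:
  assumes "(x, y) \<in> oriented_flips n Q" "(x, z) \<in> (oriented_flips n Q)\<^sup>+"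
  shows "(z, y) \<notin> (oriented_flips n Q)\<^sup>+"
proof
  assume zy: "(z, y) \<in> (oriented_flips n Q)\<^sup>+"
  obtain i j l where f: "clockwise_flip x i j y l" using assms(1) oriented_flips_iff by blast
  obtain u where u: "(x, u) \<in> oriented_flips n Q" "(u, z) \<in> (oriented_flips n Q)\<^sup>*"
    using tranclD[OF assms(2)] by blast
  have uy: "(u, y) \<in> (oriented_flips n Q)\<^sup>+" using u(2) zy by (rule rtrancl_trancl_trancl)
  obtain i' j' l' where f': "clockwise_flip x i' j' u l'" using u(1) oriented_flips_iff by blast
  have "i' \<notin> y" using removed_edge_never_returns[OF f'] uy by (simp add: trancl_into_rtrancl)
  then have "i' = i" using f f' by (auto simp: clockwise_flip_def flip_def)
  then have "j' = j" using clockwise_flip_unique f f' by blast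
  then have "u = y" using f f' \<open>i' = i\<close> by (auto simp: clockwise_flip_def flip_def)
  then show False using uy acyclic_oriented_flips by blast
qed

definition flip_order :: "edge set rel" where
  "flip_order = {(y, x). x \<in> compatible_quadrangulations n Q \<and> (x, y) \<in> (oriented_flips n Q)\<^sup>*}"

lemma reachable_compatible:
  assumes "(x, y) \<in> (oriented_flips n Q)\<^sup>*" "x \<in> compatible_quadrangulations n Q"
  shows "y \<in> compatible_quadrangulations n Q"
  using assms by (induction rule: rtrancl_induct) (auto dest: oriented_flips_vertices)

lemma partial_order_flip_order: "partial_order_on (compatible_quadrangulations n Q) flip_order"
proof -
  have "x = y" if "(x, y) \<in> (oriented_flips n Q)\<^sup>*" "(y, x) \<in> (oriented_flips n Q)\<^sup>*" for x y
    using that acyclic_oriented_flips by (metis rtranclD rtrancl_trancl_trancl)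
  then have "antisym flip_order" by (auto simp: antisym_def flip_order_def)
  moreover have "trans flip_order" by (auto simp: trans_def flip_order_def)
  moreover have "refl_on (compatible_quadrangulations n Q) flip_order"
    by (auto simp: refl_on_def flip_order_def dest: reachable_compatible)
  moreover have "flip_order \<subseteq> compatible_quadrangulations n Q \<times> compatible_quadrangulations n Q"
    by (auto simp: flip_order_def dest: reachable_compatible)
  ultimately show ?thesis by (simp add: partial_order_on_def preorder_on_def)
qed

lemma hasse_diagram_flip_order:
  "hasse_diagram (compatible_quadrangulations n Q) flip_order = flip_digraph n Q"
proof -
  let ?A = "compatible_quadrangulations n Q" and ?F = "oriented_flips n Q"
  have "(x, y) \<in> ?F \<longleftrightarrow> (y, x) \<in> flip_order \<and> y \<noteq> x \<and>
      \<not> (\<exists>z. (y, z) \<in> flip_order \<and> (z, x) \<in> flip_order \<and> z \<noteq> x \<and> z \<noteq> y)" for x y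
  proof
    assume F: "(x, y) \<in> ?F"
    then have "(y, x) \<in> flip_order" by (auto simp: flip_order_def dest: oriented_flips_vertices)
    moreover have "y \<noteq> x" using F acyclic_oriented_flips by blast
    moreover have False if "(y, z) \<in> flip_order" "(z, x) \<in> flip_order" "z \<noteq> x" "z \<noteq> y" for z
    proof -
      have "(x, z) \<in> ?F\<^sup>+" "(z, y) \<in> ?F\<^sup>+"
        using that by (auto simp: flip_order_def dest: rtranclD)
      then show False using oriented_flips_reduced[OF F] by blast
    qed
    ultimately show "(y, x) \<in> flip_order \<and> y \<noteq> x \<and>
      \<not> (\<exists>z. (y, z) \<in> flip_order \<and> (z, x) \<in> flip_order \<and> z \<noteq> x \<and> z \<noteq> y)" by blast
  next
    assume c: "(y, x) \<in> flip_order \<and> y \<noteq> x \<and>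
      \<not> (\<exists>z. (y, z) \<in> flip_order \<and> (z, x) \<in> flip_order \<and> z \<noteq> x \<and> z \<noteq> y)"
    then have "x \<in> ?A" "(x, y) \<in> ?F\<^sup>+" by (auto simp: flip_order_def dest: rtranclD)
    then obtain z where z: "(x, z) \<in> ?F" "(z, y) \<in> ?F\<^sup>*" using tranclD by metis
    have "z \<noteq> x" using z(1) acyclic_oriented_flips by blast
    moreover have "(z, x) \<in> flip_order" "(y, z) \<in> flip_order"
      using z by (auto simp: flip_order_def dest: oriented_flips_vertices)
    ultimately have "z = y" using c by blast
    then show "(x, y) \<in> ?F" using z(1) by simp
  qed
  then show ?thesis unfolding hasse_diagram_def flip_digraph_def by auto
qed

end

section \<open>Reaching every quadrangulation from the initial one\<close>

text \<open>
  The chord \<open>W W'\<close> separates \<open>A, C\<close> from \<open>B, D\<close> and the chord \<open>V V'\<close> separates \<open>C, B\<close> from \<open>D, A\<close>, so the four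
  gaps between the four points contain one end of the chords each.
\<close>

lemma separated_ends_interleave:
  assumes "cyc A C B" "cyc A B D"
    and "cyc W A W'" "cyc W C W'" "cyc W' B W" "cyc W' D W"
    and "cyc V C V'" "cyc V B V'" "cyc V' A V" "cyc V' D V"
  shows "interleaved W W' V V'"
proof -
  have s1: "cyc A V C" using assms(1,7,9) by (smt (verit) cyclic_order)
  have s2: "cyc B V' D" using assms(8,10,2) by (smt (verit) cyclic_order)
  have s3: "cyc D W A" using assms(2,3,6) by (smt (verit) cyclic_order)
  have s4: "cyc C W' B" using assms(1,4,5) by (smt (verit) cyclic_order)
  show ?thesis
    using s1 s2 s3 s4 assms(1,2) unfolding interleaved_def
    by (smt (verit) cyclic_order)
qed

text \<open>
  This is \<open>end_in_square\<close> for the two squares on their common side \<open>c d\<close>.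
\<close>

lemma hexagon_chord:
  assumes "cyc c b y" "cyc c y d" "cyc d a x" "cyc d x c"
    and "\<not> interleaved s t c b" "\<not> interleaved s t b y" "\<not> interleaved s t y d"
    "\<not> interleaved s t d a" "\<not> interleaved s t a x" "\<not> interleaved s t x c"
    and "interleaved c d s t"
  shows "s \<in> {b, y} \<and> t \<in> {a, x} \<or> t \<in> {b, y} \<and> s \<in> {a, x}"
proof -
  have *: "u \<in> {b, y} \<and> v \<in> {a, x}"
    if "cyc c u d" "cyc d v c" "(u, v) = (s, t) \<or> (u, v) = (t, s)" for u v
  proof -
    have ni: "\<not> interleaved u v c b" "\<not> interleaved u v b y" "\<not> interleaved u v y d"
      "\<not> interleaved v u d a" "\<not> interleaved v u a x" "\<not> interleaved v u x c"
      using that(3) assms(5-10) interleaved_flip(1) by blast+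
    then show ?thesis
      using end_in_square[OF assms(1,2) that(1,2) ni(1-3)]
        end_in_square[OF assms(3,4) that(2,1) ni(4-6)]
      by blast
  qed
  show ?thesis using assms(11) *[of s t] *[of t s] unfolding interleaved_def by blast
qed

text \<open>
  The hexagon \<open>a x c b y d\<close> has three long diagonals, and any two of them cross. Every edge that
  crosses one of them but no side of the hexagon is another one of them. So exchanging one for
  another keeps the set noncrossing and maximal.
\<close>

lemma flip_in_hexagon:
  assumes max: "maximal_noncrossing n D" and cd: "(c, d) \<in> D" and par: "even a" "odd b"
    and cyc: "cyc c b y" "cyc c y d" "cyc d a x" "cyc d x c"
    and j: "joined n D c b" "joined n D b y" "joined n D y d" "joined n D d a" "joined n D a x"
      "joined n D x c"
  shows "maximal_noncrossing n (insert (a, b) (D - {(c, d)}))" "interleaved a b c d"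
proof -
  let ?D = "insert (a, b) (D - {(c, d)})"
  have D: "D \<subseteq> diagonals n" "noncrossing D" using max by (auto simp: maximal_noncrossing_def)
  note lt = j[THEN joined_bounds(1)[OF _ D(1)]]
  have pars: "even c" "odd d" "even y" "odd x"
    using j[THEN joined_bounds(3)[OF _ D(1)]] par by blast+
  show i: "interleaved a b c d" using cyc unfolding interleaved_def by (smt (verit) cyclic_order)
  have xy: "interleaved x y c d" "interleaved x y a b"
    using cyc unfolding interleaved_def by (smt (verit) cyclic_order)+
  have cyc': "cyc a x c" "cyc a c b" "cyc b y d" "cyc b d a"
    using cyc by (smt (verit) cyclic_order)+
  have "(a, b) \<in> edges n" using lt par by (auto simp: edges_def)
  moreover have "(a, b) \<notin> boundary n" using boundary_not_interleaved[of a b n c d] i lt by blast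
  ultimately have sub: "?D \<subseteq> diagonals n" using D(1) by (auto simp: diagonals_def)
  have new: "\<not> interleaved a b s t" if st: "(s, t) \<in> D - {(c, d)}" for s t
  proof
    assume ab: "interleaved a b s t"
    have js: "joined n D s t" using st by (auto simp: joined_def)
    have "even s" "odd t" using st D(1) diagonals_edges edgesD[of "(s, t)" n] by auto
    note ni = j[THEN joined_not_interleaved[OF D js]]
    have "s \<in> {x, c} \<and> t \<in> {y, d} \<or> t \<in> {x, c} \<and> s \<in> {y, d}"
      using hexagon_chord[OF cyc' ni(5,6,1,2,3,4) ab] .
    then have "s = y \<and> t = x" using st \<open>even s\<close> \<open>odd t\<close> pars by auto
    then have "interleaved s t c d" using xy(1) interleaved_flip(1) by blast
    then show False using D(2) st cd by (force simp: noncrossing_def)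
  qed
  have "noncrossing ?D"
    unfolding noncrossing_def
  proof (intro ballI)
    fix e f assume "e \<in> ?D" "f \<in> ?D"
    then consider "e \<in> D" "f \<in> D" | "e = (a, b)" "f = (a, b)" | "e = (a, b)" "f \<in> D - {(c, d)}"
      | "f = (a, b)" "e \<in> D - {(c, d)}" by blast
    then show "\<not> interleaved (fst e) (snd e) (fst f) (snd f)"
    proof cases
      case 1 then show ?thesis using D(2) by (simp add: noncrossing_def)
    next
      case 2 then show ?thesis by simp
    next
      case 3 then show ?thesis using new[of "fst f" "snd f"] by simp
    next
      case 4
      then show ?thesis
        using new[of "fst e" "snd e"] interleaved_sym[of "fst e" "snd e" a b] by auto
    qed
  qed
  moreover have "\<exists>f\<in>?D. interleaved (fst e) (snd e) (fst f) (snd f)" if e: "e \<in> diagonals n - ?D"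
    for e
  proof (rule ccontr)
    assume no: "\<not> ?thesis"
    obtain s t where st: "e = (s, t)" by (cases e)
    have "e \<noteq> (c, d)" using no i interleaved_sym by (metis fst_conv insertI1 snd_conv)
    then obtain f where f: "f \<in> D" "interleaved s t (fst f) (snd f)"
      using max e unfolding maximal_noncrossing_def st by force
    have "f = (c, d)" using no f by (auto simp: st)
    then have cross: "interleaved c d s t" using f(2) interleaved_sym by simp
    have stE: "s < 2 * n + 2" "t < 2 * n + 2" "even s" "odd t"
      using e diagonals_edges edgesD[of e n] st by auto
    have ni: "\<not> interleaved s t u v" if uv: "joined n D u v" "(u, v) \<noteq> (c, d)" "(v, u) \<noteq> (c, d)"
      for u v
    proof -
      consider "(u, v) \<in> ?D" | "(v, u) \<in> ?D" | "(u, v) \<in> boundary n" | "(v, u) \<in> boundary n"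
        using uv unfolding joined_def by blast
      then show ?thesis
      proof cases
        case 1 then show ?thesis using no by (force simp: st)
      next
        case 2 then have "\<not> interleaved s t v u" using no by (force simp: st)
        then show ?thesis using interleaved_flip(2) by blast
      next
        case 3 then show ?thesis using boundary_not_interleaved stE interleaved_sym by blast
      next
        case 4 then have "\<not> interleaved s t v u"
          using boundary_not_interleaved stE interleaved_sym by blast
        then show ?thesis using interleaved_flip(2) by blast
      qed
    qed
    have "c \<notin> {b, y, d, a, x}" "d \<notin> {b, y, a, x}"
      using cyc[THEN cyc_distinct] cyc_distinct[OF cyc_trans[OF cyc(1,2)]]
        cyc_distinct[OF cyc_trans[OF cyc(3,4)]] by auto
    then have "s \<in> {b, y} \<and> t \<in> {a, x} \<or> t \<in> {b, y} \<and> s \<in> {a, x}"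
      by (intro hexagon_chord[OF cyc _ _ _ _ _ _ cross] ni j) auto
    moreover have "s \<noteq> a \<or> t \<noteq> b" using e by (auto simp: st)
    ultimately have "s = y \<and> t = x" using stE(3,4) par pars by blast
    then have "interleaved s t a b" using xy(2) interleaved_flip(1) by blast
    then show False using no by (auto simp: st)
  qed
  ultimately show "maximal_noncrossing n ?D" using sub by (simp add: maximal_noncrossing_def)
qed

context blue_quadrangulation
begin

text \<open>
  Suppose that a red edge crosses a blue one in the forbidden direction and both belong to \<open>Q\<close>.
  Their colours keep their indices distinct at the two places where the half step could hide a
  common end, so already within one polygon the two edges cross.
\<close>

lemma Q_compatible: "Q \<in> compatible_quadrangulations n Q"
proof -
  have "west l w" if "(w, b) \<in> Q" "l \<in> Q" "west l b" for w b l
  proof (rule ccontr)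
    assume "\<not> west l w"
    then have c: "cyc (2 * fst l) (2 * b + 1) (2 * snd l)" "cyc (2 * snd l) (2 * w + 1) (2 * fst l)"
      using that not_west[OF Q_edges] by (auto simp: west_def)
    have "odd b" "even w" "even (fst l)" "odd (snd l)"
      using edgesD[OF Q_edges[OF that(1)]] edgesD[OF Q_edges[OF that(2)]] by auto
    then have "b \<noteq> fst l" "w \<noteq> snd l" by auto
    then have "cyc (fst l) b (snd l)" "cyc (snd l) w (fst l)"
      using c unfolding cyc_def by presburger+
    then have "interleaved (fst l) (snd l) w b" by (simp add: interleaved_def)
    then show False using maximal that by (force simp: maximal_noncrossing_def noncrossing_def)
  qed
  then show ?thesis using compatible_quadrangulations_iff maximal by auto
qed

lemma missing_diagonal:
  assumes "D \<in> compatible_quadrangulations n Q" "D \<noteq> Q"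
  obtains l where "l \<in> Q" "l \<notin> D"
proof -
  have "\<not> Q \<subseteq> D"
  proof
    assume "Q \<subseteq> D"
    then obtain e where e: "e \<in> D" "e \<notin> Q" using assms(2) by blast
    then obtain f where "f \<in> Q" "interleaved (fst e) (snd e) (fst f) (snd f)"
      using maximal compatibleD(2)[OF assms(1)] unfolding maximal_noncrossing_def by blast
    then show False using e(1) \<open>Q \<subseteq> D\<close> compatibleD(3)[OF assms(1)] by (auto simp: noncrossing_def)
  qed
  then show ?thesis using that by blast
qed

lemma last_passing_side:
  assumes "l \<in> edges n" "passes (c, d) l" "c < M" "d < M" "d = next_vertex n c"
  shows "d = snd l"
proof -
  have "cyc (2 * fst l) (2 * c + 1) (2 * snd l)" "cyc (2 * snd l) (2 * d + 1) (2 * fst l)"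
    using assms(2) not_west[OF assms(1)] by (auto simp: passes_def west_def)
  then have "cyc (2 * c + 1) (2 * snd l) (2 * d + 1)" by (smt (verit) cyclic_order)
  then show ?thesis
    using between_neighbours(1)[OF assms(3), of "snd l"] edgesD[OF assms(1)] assms(5) by auto
qed

lemma first_passing_side:
  assumes "l \<in> edges n" "passes (c, d) l" "c < M" "d < M" "c = next_vertex n d"
  shows "c = fst l"
proof -
  have "cyc (2 * fst l) (2 * c + 1) (2 * snd l)" "cyc (2 * snd l) (2 * d + 1) (2 * fst l)"
    using assms(2) not_west[OF assms(1)] by (auto simp: passes_def west_def)
  then have "cyc (2 * d + 1) (2 * fst l) (2 * c + 1)" by (smt (verit) cyclic_order)
  then show ?thesis
    using between_neighbours(1)[OF assms(4), of "fst l"] edgesD[OF assms(1)] assms(5) by auto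
qed

text \<open>
  The edge \<open>l\<close> leaves the square beyond \<open>(c, d)\<close> through a side adjacent to \<open>(c, d)\<close>: it would cross the
  opposite side in the forbidden direction. Hence consecutive points of the staircase share a
  coordinate.
\<close>

lemma square_after:
  assumes D: "D \<in> compatible_quadrangulations n Q" and l: "l \<in> Q"
    and cd: "(c, d) \<in> D \<union> boundary n" "passes (c, d) l" "d \<noteq> snd l"
  obtains x y where "cyc c x y" "cyc c y d" "joined n D c x" "joined n D x y" "joined n D y d"
    "passes (c, x) l \<and> turn M (fst l) x < turn M (fst l) d \<or> passes (y, d) l \<and>
      turn M (fst l) c < turn M (fst l) y"
proof -
  note D' = compatibleD[OF D] and lE = Q_edges[OF l]
  have jcd: "joined n D c d" using cd(1) by (simp add: joined_def)
  have cdE: "(c, d) \<in> edges n" using cd(1) D'(2) diagonals_edges boundary_edges by blast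
  have lt: "c < M" "d < M" "even c" "odd d" using edgesD[OF cdE] by auto
  have "d \<noteq> next_vertex n c" using last_passing_side[OF lE cd(2) lt(1,2)] cd(3) by blast
  then obtain x y where xy: "x < M" "y < M" "cyc c x y" "cyc c y d" "joined n D c x"
    "joined n D x y" "joined n D y d"
    using square_on_side[OF D'(1) jcd] by metis
  have w: "west l c" "\<not> west l d" using cd(2) by (auto simp: passes_def)
  then have "turn M (fst l) c < turn M (fst l) d" using turn_west_east lE lt by blast
  then have t: "turn M (fst l) c < turn M (fst l) x" "turn M (fst l) x < turn M (fst l) y"
    "turn M (fst l) y < turn M (fst l) d"
    using cyc_turn_edge[OF lE lt(1) xy(1,2,3)] cyc_turn_edge[OF lE lt(1) xy(2) lt(2) xy(4)]
    unfolding cyc_def by linarith+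
  have "passes (c, x) l \<and> turn M (fst l) x < turn M (fst l) d \<or> passes (y, d) l \<and>
    turn M (fst l) c < turn M (fst l) y"
  proof (cases "west l x")
    case False
    then show ?thesis using w t by (simp add: passes_def)
  next
    case True
    have "even y" using lt xy(5,6) joined_bounds(3)[OF _ D'(2)] by blast
    then have "(y, x) \<in> D \<union> boundary n" using joined_white joined_sym xy(6) D'(2) by blast
    then have "west l y" using compatible_west[OF D _ l] True by blast
    then show ?thesis using w t by (simp add: passes_def)
  qed
  then show ?thesis using that xy by blast
qed

text \<open>
  The counterpart of \<open>square_after\<close> for the square through which \<open>l\<close> arrives at \<open>(c, d)\<close>.
\<close>

lemma square_before:
  assumes D: "D \<in> compatible_quadrangulations n Q" and l: "l \<in> Q"
    and cd: "(c, d) \<in> D \<union> boundary n" "passes (c, d) l" "c \<noteq> fst l"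
  obtains x y where "cyc d x y" "cyc d y c" "joined n D d x" "joined n D x y" "joined n D y c"
    "passes (x, d) l \<and> turn M (fst l) x < turn M (fst l) c \<or> passes (c, y) l \<and>
      turn M (fst l) d < turn M (fst l) y"
proof -
  note D' = compatibleD[OF D] and lE = Q_edges[OF l]
  have jdc: "joined n D d c" using cd(1) by (simp add: joined_def)
  have cdE: "(c, d) \<in> edges n" using cd(1) D'(2) diagonals_edges boundary_edges by blast
  have lt: "c < M" "d < M" "even c" "odd d" using edgesD[OF cdE] by auto
  have "c \<noteq> next_vertex n d" using first_passing_side[OF lE cd(2) lt(1,2)] cd(3) by blast
  then obtain x y where xy: "x < M" "y < M" "cyc d x y" "cyc d y c" "joined n D d x"
    "joined n D x y" "joined n D y c"
    using square_on_side[OF D'(1) jdc] by metis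
  have w: "west l c" "\<not> west l d" using cd(2) by (auto simp: passes_def)
  then have t: "turn M (fst l) c < turn M (fst l) d" using turn_west_east lE lt by blast
  have dxc: "cyc d x c" using xy(3,4) by (smt (verit) cyclic_order)
  have "passes (x, d) l \<and> turn M (fst l) x < turn M (fst l) c \<or> passes (c, y) l \<and>
    turn M (fst l) d < turn M (fst l) y"
  proof (cases "west l y")
    case False
    then have "turn M (fst l) c < turn M (fst l) y" using turn_west_east lE lt xy w by blast
    then have "turn M (fst l) d < turn M (fst l) y"
      using cyc_turn_edge[OF lE lt(2) xy(2) lt(1) xy(4)] t unfolding cyc_def by linarith
    then show ?thesis using w False by (simp add: passes_def)
  next
    case True
    have "even x" using lt xy(5) joined_bounds(3)[OF _ D'(2)] by blast
    then have "(x, y) \<in> D \<union> boundary n" using joined_white xy(6) D'(2) by blast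
    then have wx: "west l x" using compatible_west[OF D _ l] True by blast
    then have "turn M (fst l) x < turn M (fst l) d" using turn_west_east lE lt xy w by blast
    then have "turn M (fst l) x < turn M (fst l) c"
      using cyc_turn_edge[OF lE lt(2) xy(1) lt(1) dxc] t unfolding cyc_def by linarith
    then show ?thesis using w wx by (simp add: passes_def)
  qed
  then show ?thesis using that xy by blast
qed

text \<open>
  The staircase starts with the boundary edge around the white end of \<open>l\<close>.
\<close>

lemma first_side_passes:
  assumes "l \<in> edges n"
  obtains v where "(fst l, v) \<in> boundary n" "passes (fst l, v) l"
proof -
  define v where "v = (if fst l = 0 then 2 * n + 1 else fst l - 1)"
  note l = edgesD[OF assms]
  have v: "v < M" "odd v" "next_vertex n v = fst l" using l by (auto simp: v_def next_vertex_if)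
  then have "(fst l, v) \<in> boundary n" using l by (auto simp: boundary_iff edges_def)
  moreover have "fst l \<noteq> snd l" using l by auto
  then have "west l (fst l)" using l unfolding west_def cyc_def by presburger
  moreover have "turn M (fst l) v = M - 1" "turn M (fst l) (snd l) \<le> M - 1"
    using l by (auto simp: turn_def v_def)
  then have "\<not> west l v" using west_iff_turn[OF assms v(1)] by simp
  ultimately show ?thesis using that by (auto simp: passes_def)
qed

text \<open>
  Follow the staircase down the column of the smallest white coordinate to its lowest point, with
  black end \<open>v\<close>. This is not the black end of \<open>l\<close>, as \<open>l\<close> is not in \<open>D\<close>. Then follow the row of \<open>v\<close> to its
  last point, with white end \<open>u\<close>. There the staircase turns down again, and \<open>(u, v)\<close> is an outer
  corner.
\<close>

lemma flippable_corner:
  assumes D: "D \<in> compatible_quadrangulations n Q" and l: "l \<in> Q" "l \<notin> D"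
  obtains a b c d x y where "(c, d) \<in> D"
    "cyc c b y" "cyc c y d" "joined n D c b" "joined n D b y" "joined n D y d"
    "cyc d a x" "cyc d x c" "joined n D d a" "joined n D a x" "joined n D x c"
    "passes (a, d) l" "passes (c, b) l"
    "turn M (fst l) a < turn M (fst l) c" "turn M (fst l) b < turn M (fst l) d"
proof -
  note D' = compatibleD[OF D] and lE = Q_edges[OF l(1)]
  let ?t = "turn M (fst l)" and ?w = "fst l"
  have edge: "(c, d) \<in> edges n" if "(c, d) \<in> D \<union> boundary n" for c d
    using that D'(2) diagonals_edges boundary_edges by blast
  \<comment> \<open>The column of the staircase over the smallest white coordinate, and its lowest point.\<close>
  define X where "X = (\<lambda>b. (?w, b) \<in> D \<union> boundary n \<and> passes (?w, b) l)"
  obtain v0 where "X v0" using first_side_passes[OF lE] by (auto simp: X_def)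
  then obtain v where v: "X v" "\<And>b. X b \<Longrightarrow> ?t v \<le> ?t b"
    using ex_has_least_nat[of X v0 ?t] by blast
  have "v \<noteq> snd l"
  proof
    assume "v = snd l"
    then have "l \<in> D \<union> boundary n" using v(1) by (simp add: X_def)
    then show False using l Q_diagonals by (auto simp: diagonals_def)
  qed
  \<comment> \<open>The row through that point, and its last point.\<close>
  define Y where "Y = (\<lambda>c. (c, v) \<in> D \<union> boundary n \<and> passes (c, v) l)"
  have Yw: "Y ?w" using v(1) by (simp add: X_def Y_def)
  have bound: "?t c < M" if "Y c" for c
    using that edgesD[OF edge[of c v]] edgesD[OF lE] by (auto simp: Y_def turn_def)
  then obtain u where u: "Y u" "\<And>c. Y c \<Longrightarrow> ?t c \<le> ?t u"
    using ex_has_greatest_nat[of Y ?w ?t M] Yw bound by blast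
  have uv: "(u, v) \<in> D \<union> boundary n" "passes (u, v) l" using u(1) by (auto simp: Y_def)
  have wv: "(?w, v) \<in> D \<union> boundary n" "passes (?w, v) l" using v(1) by (auto simp: X_def)
  have t0: "?t ?w = 0" by (simp add: turn_def)
  have "0 < ?t u"
  proof -
    obtain x y where xy: "joined n D ?w x" "joined n D y v"
      "passes (?w, x) l \<and> ?t x < ?t v \<or> passes (y, v) l \<and> ?t ?w < ?t y"
      using square_after[OF D l(1) wv \<open>v \<noteq> snd l\<close>] by metis
    have par: "even ?w" "odd v" using edgesD[OF lE] edgesD[OF edge[OF wv(1)]] by auto
    have "(?w, x) \<in> D \<union> boundary n" using joined_white xy(1) D'(2) par by blast
    then have "\<not> (passes (?w, x) l \<and> ?t x < ?t v)" using v(2)[of x] by (auto simp: X_def)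
    then have y: "passes (y, v) l" "?t ?w < ?t y" using xy(3) by auto
    have "even y" using joined_bounds(3)[OF xy(2) D'(2)] par by blast
    then have "Y y" using joined_white xy(2) D'(2) y(1) by (auto simp: Y_def)
    then show ?thesis using u(2)[of y] y(2) by linarith
  qed
  then have "u \<noteq> ?w" using t0 by auto
  have uvE: "u < M" "v < M" "even u" "odd v" using edgesD[OF edge[OF uv(1)]] by auto
  have uvD: "(u, v) \<in> D"
    using uv last_passing_side[OF lE uv(2) uvE(1,2)] first_passing_side[OF lE uv(2) uvE(1,2)]
      \<open>u \<noteq> ?w\<close> \<open>v \<noteq> snd l\<close> by (auto simp: boundary_iff)
  obtain b y where after: "cyc u b y" "cyc u y v" "joined n D u b" "joined n D b y" "joined n D y v"
    and ab: "passes (u, b) l \<and> ?t b < ?t v \<or> passes (y, v) l \<and> ?t u < ?t y"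
    using square_after[OF D l(1) uv \<open>v \<noteq> snd l\<close>] by metis
  have "even y" using joined_bounds(3)[OF after(5) D'(2)] uvE by blast
  then have "(y, v) \<in> D \<union> boundary n" using joined_white after(5) D'(2) by blast
  then have "\<not> (passes (y, v) l \<and> ?t u < ?t y)" using u(2)[of y] by (auto simp: Y_def)
  then have b: "passes (u, b) l" "?t b < ?t v" using ab by auto
  obtain a x where before: "cyc v a x" "cyc v x u" "joined n D v a" "joined n D a x"
    "joined n D x u"
    and bb: "passes (a, v) l \<and> ?t a < ?t u \<or> passes (u, x) l \<and> ?t v < ?t x"
    using square_before[OF D l(1) uv \<open>u \<noteq> ?w\<close>] by metis
  have "(u, x) \<in> D \<union> boundary n" using joined_white joined_sym before(5) D'(2) uvE by blast
  moreover have "\<not> interleaved ?w v u x"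
    using joined_not_interleaved[OF D'(2,3), of ?w v u x] wv(1) calculation
    by (auto simp: joined_def)
  ultimately have "\<not> (passes (u, x) l \<and> ?t v < ?t x)"
    using interleaved_iff_turn[OF lE edge[OF wv(1)] edge _ , of u x] wv(2) t0 \<open>0 < ?t u\<close> by auto
  then have a: "passes (a, v) l" "?t a < ?t u" using bb by auto
  show ?thesis using that[OF uvD after before a(1) b(1) a(2) b(2)] .
qed

text \<open>
  If an edge \<open>l2\<close> of \<open>Q\<close> crossed the new diagonal \<open>(a, b)\<close> in the forbidden direction, compatibility of
  the sides \<open>(a, d)\<close> and \<open>(c, b)\<close> would put \<open>c\<close> and \<open>b\<close> on one side of \<open>l2\<close> and \<open>a\<close> and \<open>d\<close> on the other, so
  that \<open>l2\<close> would cross \<open>l\<close>.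
\<close>

lemma incoming_flip:
  assumes D: "D \<in> compatible_quadrangulations n Q" and "D \<noteq> Q"
  obtains D' where "(D', D) \<in> oriented_flips n Q"
proof -
  obtain l where l: "l \<in> Q" "l \<notin> D" using missing_diagonal[OF assms] .
  obtain a b c d x y where cd: "(c, d) \<in> D"
    and after: "cyc c b y" "cyc c y d" "joined n D c b" "joined n D b y" "joined n D y d"
    and before: "cyc d a x" "cyc d x c" "joined n D d a" "joined n D a x" "joined n D x c"
    and p: "passes (a, d) l" "passes (c, b) l"
    and t: "turn M (fst l) a < turn M (fst l) c" "turn M (fst l) b < turn M (fst l) d"
    using flippable_corner[OF D l] .
  note D' = compatibleD[OF D] and lE = Q_edges[OF l(1)]
  have par: "even c" "odd d" using cd D'(2) diagonals_edges edgesD[of "(c, d)" n] by auto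
  then have par': "even a" "odd b"
    using joined_bounds(3)[OF after(3) D'(2)] joined_bounds(3)[OF before(3) D'(2)] by blast+
  let ?D = "insert (a, b) (D - {(c, d)})"
  note fl = flip_in_hexagon[OF D'(1) cd par' after(1,2) before(1,2) after(3-5) before(3-5)]
  have E: "(a, d) \<in> D \<union> boundary n" "(c, b) \<in> D \<union> boundary n"
    using joined_white joined_sym before(3) after(3) D'(2) par par' by blast+
  have order: "cyc a c b" "cyc a b d" using after(1,2) before(1,2) by (smt (verit) cyclic_order)+
  have "west l2 a" if l2: "l2 \<in> Q" "west l2 b" for l2
  proof (rule ccontr)
    assume na: "\<not> west l2 a"
    then have "\<not> west l2 d" using compatible_west[OF D E(1) l2(1)] by blast
    moreover have "west l2 c" using compatible_west[OF D E(2) l2] .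
    ultimately have 2: "cyc (2 * fst l2) (2 * c + 1) (2 * snd l2)"
      "cyc (2 * fst l2) (2 * b + 1) (2 * snd l2)"
      "cyc (2 * snd l2) (2 * a + 1) (2 * fst l2)" "cyc (2 * snd l2) (2 * d + 1) (2 * fst l2)"
      using na l2 not_west[OF Q_edges] by (auto simp: west_def)
    have 1: "cyc (2 * fst l) (2 * a + 1) (2 * snd l)" "cyc (2 * fst l) (2 * c + 1) (2 * snd l)"
      "cyc (2 * snd l) (2 * b + 1) (2 * fst l)" "cyc (2 * snd l) (2 * d + 1) (2 * fst l)"
      using p not_west[OF lE] by (auto simp: passes_def west_def)
    have "interleaved (2 * fst l) (2 * snd l) (2 * fst l2) (2 * snd l2)"
      using separated_ends_interleave[of "2 * a + 1" "2 * c + 1" "2 * b + 1" "2 * d + 1"]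
        order cyc_double(1) 1 2
      by blast
    then have "interleaved (fst l) (snd l) (fst l2) (snd l2)"
      unfolding interleaved_def cyc_double(2) .
    then show False using maximal l(1) l2(1) by (auto simp: maximal_noncrossing_def noncrossing_def)
  qed
  then have "?D \<in> compatible_quadrangulations n Q"
    using fl(1) D compatible_quadrangulations_iff by auto
  moreover have abD: "(a, b) \<notin> D"
    using fl(2) cd D'(3) by (force simp: noncrossing_def)
  moreover have "(c, d) \<noteq> (a, b)" using cd abD by blast
  ultimately have "flip n Q ?D (a, b) (c, d) D"
    using cd D by (auto simp: flip_def)
  moreover have "(a, d) \<in> ?D \<union> boundary n" "(c, b) \<in> ?D \<union> boundary n"
    using E order by auto
  ultimately have "clockwise_flip ?D (a, b) (c, d) D l"
    using l(1) p t by (simp add: clockwise_flip_def)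
  then show ?thesis using that oriented_flips_iff by blast
qed

lemma finite_compatible_quadrangulations: "finite (compatible_quadrangulations n Q)"
proof (rule finite_subset)
  show "compatible_quadrangulations n Q \<subseteq> Pow ({..<M} \<times> {..<M})"
    using compatibleD(2) by (fastforce simp: diagonals_def edges_def)
qed simp

text \<open>
  The finite acyclic relation of arrows is well founded, so going backwards from \<open>D\<close> stops; it can
  stop only at \<open>Q\<close>.
\<close>

lemma reachable_from_Q:
  assumes "D \<in> compatible_quadrangulations n Q"
  shows "(Q, D) \<in> (oriented_flips n Q)\<^sup>*"
proof -
  have "oriented_flips n Q \<subseteq> compatible_quadrangulations n Q \<times> compatible_quadrangulations n Q"
    using oriented_flips_vertices by auto
  then have "finite (oriented_flips n Q)"
    using finite_compatible_quadrangulations finite_subset by blast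
  moreover have "acyclic (oriented_flips n Q)"
    using acyclic_oriented_flips by (simp add: acyclic_def)
  ultimately have "wf (oriented_flips n Q)" by (rule finite_acyclic_wf)
  then show ?thesis using assms
  proof (induction D rule: wf_induct_rule)
    case (less D)
    show ?case
    proof (cases "D = Q")
      case False
      then obtain D' where D': "(D', D) \<in> oriented_flips n Q"
        using incoming_flip less.prems by blast
      then have "(Q, D') \<in> (oriented_flips n Q)\<^sup>*" using less.IH oriented_flips_vertices(1) by blast
      then show ?thesis using D' by (rule rtrancl_into_rtrancl)
    qed simp
  qed
qed

lemma connected_flip_graph: "connected_graph (flip_graph n Q)"
proof -
  let ?E = "{(u, v). {u, v} \<in> snd (flip_graph n Q)}"
  have E: "?E = {(u, v). {u, v} \<in> {{x, y} | x y. (x, y) \<in> oriented_flips n Q}}"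
    by (simp add: flip_graph_def underlying_graph_def flip_digraph_def)
  have "(u, v) \<in> ?E \<and> (v, u) \<in> ?E" if "(u, v) \<in> oriented_flips n Q" for u v
    unfolding E using that by (auto simp: insert_commute)
  then have sub: "oriented_flips n Q \<subseteq> ?E" "(oriented_flips n Q)\<inverse> \<subseteq> ?E" by auto
  have "(x, y) \<in> ?E\<^sup>*" if "x \<in> compatible_quadrangulations n Q"
    "y \<in> compatible_quadrangulations n Q" for x y
  proof -
    have "(x, Q) \<in> ((oriented_flips n Q)\<inverse>)\<^sup>*"
      using reachable_from_Q[OF that(1)] by (simp add: rtrancl_converse)
    then have "(x, Q) \<in> ?E\<^sup>*" using rtrancl_mono[OF sub(2)] by blast
    moreover have "(Q, y) \<in> ?E\<^sup>*"
      using reachable_from_Q[OF that(2)] rtrancl_mono[OF sub(1)] by blast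
    ultimately show ?thesis by (rule rtrancl_trans)
  qed
  moreover have "fst (flip_graph n Q) = compatible_quadrangulations n Q"
    by (simp add: flip_graph_def underlying_graph_def flip_digraph_def)
  ultimately show ?thesis
    using Q_compatible unfolding connected_graph_def by auto
qed

end

theorem proposition1p10:
  fixes n :: nat and Q :: "edge set"
  assumes "n \<ge> 1" and "quadrangulation n (blue n) Q"
  shows "(\<exists>A r. partial_order_on A r \<and> flip_digraph n Q = hasse_diagram A r \<and> connected_poset A r) \<and>
    connected_graph (flip_graph n Q)"
proof -
  interpret blue_quadrangulation n Q using assms by unfold_locales
  have "connected_poset (compatible_quadrangulations n Q) flip_order"
    unfolding connected_poset_def hasse_diagram_flip_order
    using connected_flip_graph by (simp add: flip_graph_def)
  then show ?thesis
    using partial_order_flip_order hasse_diagram_flip_order connected_flip_graph by metis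
qed

end
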